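(* Let $r\ge 1$. Let $X$ and $Y$ be connected $C^r$-manifolds (possibly with boundary) of equal dimensions, with $X$ compact. Let $f\colon X\to Y$ be a $C^r$-mapping whose differential $\mathrm{d}f$ is nondegenerate on $X$ (that is, $\operatorname{rank}(\mathrm{d}f)=\dim X$ at every point of $X$), and such that $f(\partial X)\subseteq\partial Y$. Suppose that there is no proper subgroup of finite index in the fundamental group $\pi_1(Y)$ that is isomorphic to $\pi_1(X)$. Then $f$ is a $C^r$-diffeomorphism of $X$ onto $Y$.
   Context: An $n$-dimensional topological manifold is a Hausdorff space having a countable cover by open sets each homeomorphic either to $\mathbb{R}^n$ or to $\mathbb{R}^n_+=\{(x_1,\ldots,x_n): x_i\in\mathbb{R},\ x_1\ge 0\}$; its boundary $\partial X$ is the set of points having no neighborhood homeomorphic to $\mathbb{R}^n$ (it may be empty). A chart is a homeomorphism of an open domain $U\subset X$ to $\mathbb{R}^n$ or $\mathbb{R}^n_+$; a $C^r$-structure is a cover of $X$ by charts whose transition maps and their inverses are pairwise $C^r$-smooth, two structures being equivalent if their union is also a $C^r$-structure. A $C^r$-manifold is a topological manifold with an equivalence class of $C^r$-structures. A $C^r$-mapping is a continuous mapping that is $C^r$-smooth in charts. A $C^r$-diffeomorphism is a bijective $C^r$-mapping whose inverse is also a $C^r$-mapping. A proper subgroup is a subgroup that does not coincide with the whole group. *)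

theory Defs
  imports "HOL-Analysis.Analysis" "HOL-Algebra.Coset"
begin

section \<open>Topological manifolds with boundary\<close>

text \<open>The dimension is the size of the index type \<open>'n\<close>; the least index plays the role of the
  first coordinate.\<close>

definition half_space :: "(real ^ 'n::{finite,linorder}) set" where
  "half_space = {x. 0 \<le> x $ Min UNIV}"

definition topological_manifold ::
  "'n::{finite,linorder} itself \<Rightarrow> 'a::topological_space set \<Rightarrow> bool" where
  "topological_manifold _ X \<longleftrightarrow>
     Hausdorff_space (top_of_set X) \<and>
     (\<exists>\<U>. countable \<U> \<and> \<Union>\<U> = X \<and>
        (\<forall>U\<in>\<U>. openin (top_of_set X) U \<and>
           (U homeomorphic (UNIV :: (real ^ 'n::{finite,linorder}) set) \<or>
            U homeomorphic (half_space :: (real ^ 'n::{finite,linorder}) set))))"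

definition manifold_boundary ::
  "'n::finite itself \<Rightarrow> 'a::topological_space set \<Rightarrow> 'a set" where
  "manifold_boundary _ X =
     {x \<in> X. \<not> (\<exists>U. openin (top_of_set X) U \<and> x \<in> U \<and> U homeomorphic (UNIV :: (real ^ 'n) set))}"


section \<open>Smoothness in Euclidean space\<close>

text \<open>\<open>k\<close>-fold continuous differentiability on an \<^emph>\<open>open\<close> set \<open>W\<close> (of a finite-dimensional space):
  all iterated directional derivatives up to order \<open>k\<close> exist and are continuous.\<close>

primrec times_cont_diff_on ::
  "nat \<Rightarrow> ('a::euclidean_space \<Rightarrow> 'b::euclidean_space) \<Rightarrow> 'a set \<Rightarrow> bool" where
  "times_cont_diff_on 0 g W \<longleftrightarrow> continuous_on W g"
| "times_cont_diff_on (Suc k) g W \<longleftrightarrow>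
     (\<forall>x\<in>W. g differentiable (at x)) \<and>
     (\<forall>v. times_cont_diff_on k (\<lambda>x. frechet_derivative g (at x) v) W)"

text \<open>Smoothness on a set \<open>S\<close> that need not be open (here: relatively open in a half-space) means
  local extendability to a smooth map on an open set. The value \<open>r = \<infinity>\<close> is allowed.\<close>

definition Cr_on ::
  "enat \<Rightarrow> ('a::euclidean_space \<Rightarrow> 'b::euclidean_space) \<Rightarrow> 'a set \<Rightarrow> bool" where
  "Cr_on r h S \<longleftrightarrow>
     (\<forall>p\<in>S. \<exists>W g. open W \<and> p \<in> W \<and> (\<forall>x\<in>S \<inter> W. g x = h x) \<and>
        (\<forall>k. enat k \<le> r \<longrightarrow> times_cont_diff_on k g W))"


section \<open>Smooth structures and smooth mappings\<close>

text \<open>A chart is a pair of its domain and a map whose values outside the domain are irrelevant.\<close>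

type_synonym ('a, 'n) chart = "'a set \<times> ('a \<Rightarrow> real ^ 'n)"

definition is_chart ::
  "'a::topological_space set \<Rightarrow> ('a, 'n::{finite,linorder}) chart \<Rightarrow> bool" where
  "is_chart X = (\<lambda>(U, \<phi>). openin (top_of_set X) U \<and>
     (\<exists>\<psi>. homeomorphism U UNIV \<phi> \<psi> \<or> homeomorphism U half_space \<phi> \<psi>))"

definition coord_domain ::
  "('a \<Rightarrow> 'b) \<Rightarrow> ('a, 'n) chart \<Rightarrow> ('b, 'm) chart \<Rightarrow> (real ^ 'n) set" where
  "coord_domain f = (\<lambda>(U, \<phi>) (V, \<psi>). \<phi> ` (U \<inter> f -` V))"

definition coord_rep ::
  "('a \<Rightarrow> 'b) \<Rightarrow> ('a, 'n) chart \<Rightarrow> ('b, 'm) chart \<Rightarrow> real ^ 'n \<Rightarrow> real ^ 'm" where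
  "coord_rep f = (\<lambda>(U, \<phi>) (V, \<psi>). \<psi> \<circ> f \<circ> inv_into U \<phi>)"

text \<open>The transition map from \<open>c\<close> to \<open>d\<close> is the coordinate representation of the identity. As
  \<open>(c, d)\<close> ranges over all ordered pairs, inverses are covered too.\<close>

definition Cr_structure ::
  "enat \<Rightarrow> 'a::topological_space set \<Rightarrow> ('a, 'n::{finite,linorder}) chart set \<Rightarrow> bool" where
  "Cr_structure r X A \<longleftrightarrow>
     (\<forall>c\<in>A. is_chart X c) \<and> \<Union> (fst ` A) = X \<and>
     (\<forall>c\<in>A. \<forall>d\<in>A. Cr_on r (coord_rep id c d) (coord_domain id c d))"

text \<open>The equivalence class of structures of a manifold is given by a representative \<open>A\<close>; smooth
  mappings and the rank of the differential do not depend on its choice.\<close>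

definition Cr_manifold ::
  "enat \<Rightarrow> 'a::topological_space set \<Rightarrow> ('a, 'n::{finite,linorder}) chart set \<Rightarrow> bool" where
  "Cr_manifold r X A \<longleftrightarrow> topological_manifold TYPE('n) X \<and> Cr_structure r X A"

definition Cr_mapping ::
  "enat \<Rightarrow> 'a::topological_space set \<Rightarrow> ('a, 'n::{finite,linorder}) chart set \<Rightarrow>
   'b::topological_space set \<Rightarrow> ('b, 'm::{finite,linorder}) chart set \<Rightarrow> ('a \<Rightarrow> 'b) \<Rightarrow> bool" where
  "Cr_mapping r X A Y B f \<longleftrightarrow>
     f ` X \<subseteq> Y \<and> continuous_on X f \<and>
     (\<forall>c\<in>A. \<forall>d\<in>B. Cr_on r (coord_rep f c d) (coord_domain f c d))"

definition Cr_diffeomorphism ::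
  "enat \<Rightarrow> 'a::topological_space set \<Rightarrow> ('a, 'n::{finite,linorder}) chart set \<Rightarrow>
   'b::topological_space set \<Rightarrow> ('b, 'm::{finite,linorder}) chart set \<Rightarrow> ('a \<Rightarrow> 'b) \<Rightarrow> bool" where
  "Cr_diffeomorphism r X A Y B f \<longleftrightarrow>
     bij_betw f X Y \<and> Cr_mapping r X A Y B f \<and> Cr_mapping r Y B X A (inv_into X f)"

text \<open>The rank of the differential at \<open>x\<close>, computed in a chart \<open>c\<close> around \<open>x\<close> and a chart \<open>d\<close>
  around \<open>f x\<close>. At boundary points the derivative is taken within the coordinate domain, where it
  is still unique, since that domain is relatively open in the full space or the half-space.\<close>

definition coord_rank ::
  "('a \<Rightarrow> 'b) \<Rightarrow> ('a, 'n::finite) chart \<Rightarrow> ('b, 'm::finite) chart \<Rightarrow> 'a \<Rightarrow> nat" where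
  "coord_rank f c d x =
     rank (matrix (frechet_derivative (coord_rep f c d) (at (snd c x) within coord_domain f c d)))"

definition nondegenerate_differential ::
  "'a set \<Rightarrow> ('a, 'n::finite) chart set \<Rightarrow> ('b, 'm::finite) chart set \<Rightarrow> ('a \<Rightarrow> 'b) \<Rightarrow> bool" where
  "nondegenerate_differential X A B f \<longleftrightarrow>
     (\<forall>x\<in>X. \<forall>c\<in>A. \<forall>d\<in>B. x \<in> fst c \<longrightarrow> f x \<in> fst d \<longrightarrow> coord_rank f c d x = CARD('n))"


section \<open>The fundamental group\<close>

definition loops_at :: "'a::topological_space set \<Rightarrow> 'a \<Rightarrow> (real \<Rightarrow> 'a) set" where
  "loops_at S a = {p. path p \<and> path_image p \<subseteq> S \<and> pathstart p = a \<and> pathfinish p = a}"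

definition fundamental_group ::
  "'a::topological_space set \<Rightarrow> 'a \<Rightarrow> (real \<Rightarrow> 'a) set monoid" where
  "fundamental_group S a =
     \<lparr>carrier = loops_at S a // {(p, q). homotopic_paths S p q},
      mult = (\<lambda>P Q. {r. \<exists>p\<in>P. \<exists>q\<in>Q. homotopic_paths S (p +++ q) r}),
      one = {p. homotopic_paths S (\<lambda>_. a) p}\<rparr>"

end

theory Submission
  imports Defs
begin

text \<open>
  A compact manifold \<open>X\<close> and a nondegenerate map \<open>f\<close> that sends boundary to boundary behave like a
  covering. At each point \<open>f\<close>, read in charts, extends to a smooth map between open sets of Euclidean
  space with invertible derivative (\<open>regular_local_extension\<close>), so \<open>f\<close> is locally injective. It is also
  open: at interior points by invariance of domain, and at boundary points because the hypothesis on
  boundaries forces the local extension to match the two half-spaces with each other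
  (\<open>neighbourhood_in_convex_image\<close>, \<open>nondegenerate_open_map\<close>). Since \<open>X\<close> is compact, the image of \<open>f\<close> is
  open and closed, hence all of \<open>Y\<close>, and \<open>f\<close> is a covering with finite fibres
  (\<open>compact_local_homeomorphism_covering\<close>).

  For a covering, homotopies of paths lift (\<open>homotopy_lift\<close>). Therefore the homomorphism of fundamental
  groups induced by \<open>f\<close> is injective, its image is isomorphic to the fundamental group of \<open>X\<close>, and the
  cosets of the image correspond to points of a fibre, so the index is finite. The hypothesis on
  subgroups now says that the image is the whole group. Then the covering has a single sheet, that is,
  \<open>f\<close> is injective (\<open>injective_if_no_subgroup\<close>).

  So \<open>f\<close> is a bijective open map, and its inverse is continuous. In charts the inverse is locally the
  inverse of the regular extension, which is as smooth as the extension itself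
  (\<open>times_cont_diff_on_inverse_function\<close>, \<open>inverse_Cr_mapping\<close>).
\<close>

section \<open>Calculus of iterated differentiability\<close>

lemma times_cont_diff_on_cong:
  assumes "open W" "\<And>x. x \<in> W \<Longrightarrow> f x = g x" "times_cont_diff_on k f W"
  shows "times_cont_diff_on k g W"
  using assms(2,3)
proof (induction k arbitrary: f g)
  case 0
  then show ?case by (auto cong: continuous_on_cong)
next
  case (Suc k)
  have D: "(g has_derivative frechet_derivative f (at x)) (at x)" if "x \<in> W" for x
    using Suc.prems that assms(1)
    by (metis frechet_derivative_works has_derivative_transform_within_open times_cont_diff_on.simps(2))
  then have "frechet_derivative f (at x) = frechet_derivative g (at x)" if "x \<in> W" for x
    using frechet_derivative_at that by blast
  then show ?case
    using Suc.IH[of "\<lambda>x. frechet_derivative f (at x) v" "\<lambda>x. frechet_derivative g (at x) v" for v]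
      Suc.prems(2) D by (auto simp: differentiable_def)
qed

text \<open>The form in which smoothness is established below: any candidate derivative serves, and the
  choice hidden in \<^const>\<open>frechet_derivative\<close> is resolved by uniqueness at interior points.\<close>

lemma times_cont_diff_on_SucI:
  assumes "open W" and D: "\<And>x. x \<in> W \<Longrightarrow> (f has_derivative f' x) (at x)"
    and C: "\<And>v. times_cont_diff_on k (\<lambda>x. f' x v) W"
  shows "times_cont_diff_on (Suc k) f W"
proof -
  have "times_cont_diff_on k (\<lambda>x. frechet_derivative f (at x) v) W" for v
    by (rule times_cont_diff_on_cong[OF assms(1) _ C[of v]]) (metis D frechet_derivative_at)
  then show ?thesis
    using D by (auto simp: differentiable_def)
qed

lemma times_cont_diff_on_lower:
  assumes "times_cont_diff_on (Suc k) f W"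
  shows "times_cont_diff_on k f W"
  using assms
proof (induction k arbitrary: f)
  case 0
  then show ?case
    by (auto intro!: continuous_at_imp_continuous_on differentiable_imp_continuous_within)
next
  case (Suc k)
  then show ?case
    by (metis times_cont_diff_on.simps(2))
qed

lemma times_cont_diff_on_subset:
  assumes "times_cont_diff_on k f W" "W' \<subseteq> W"
  shows "times_cont_diff_on k f W'"
  using assms
  by (induction k arbitrary: f) (auto intro: continuous_on_subset)

lemma times_cont_diff_on_derivative:
  "times_cont_diff_on (Suc k) f W \<Longrightarrow> x \<in> W \<Longrightarrow>
     (f has_derivative frechet_derivative f (at x)) (at x)"
  by (simp add: frechet_derivative_works[symmetric])

lemma times_cont_diff_on_const:
  assumes "open W" shows "times_cont_diff_on k (\<lambda>x. c) W"
proof (induction k arbitrary: c)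
  case (Suc k)
  show ?case
    by (rule times_cont_diff_on_SucI[OF assms, where f' = "\<lambda>x v. 0"]) (auto intro: Suc)
qed auto

lemma times_cont_diff_on_add:
  assumes "open W" "times_cont_diff_on k f W" "times_cont_diff_on k g W"
  shows "times_cont_diff_on k (\<lambda>x. f x + g x) W"
  using assms(2,3)
proof (induction k arbitrary: f g)
  case (Suc k)
  show ?case
    by (rule times_cont_diff_on_SucI[OF assms(1)
          has_derivative_add[OF times_cont_diff_on_derivative times_cont_diff_on_derivative]])
      (use Suc in auto)
qed (auto intro: continuous_intros)

lemma times_cont_diff_on_linear_image:
  assumes "open W" "bounded_linear L" "times_cont_diff_on k f W"
  shows "times_cont_diff_on k (\<lambda>x. L (f x)) W"
  using assms(3)
proof (induction k arbitrary: f)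
  case 0
  then show ?case
    using linear_continuous_on_compose[of W f L] assms(2) bounded_linear.linear by auto
next
  case (Suc k)
  show ?case
    by (rule times_cont_diff_on_SucI[OF assms(1)
          bounded_linear.has_derivative[OF assms(2) times_cont_diff_on_derivative]])
      (use Suc in auto)
qed

lemma times_cont_diff_on_component:
  fixes f :: "'a::euclidean_space \<Rightarrow> real ^ 'n"
  shows "open W \<Longrightarrow> times_cont_diff_on k f W \<Longrightarrow> times_cont_diff_on k (\<lambda>x. f x $ i) W"
  using times_cont_diff_on_linear_image[OF _ bounded_linear_vec_nth[of i]] by blast

lemma times_cont_diff_on_scaleR:
  fixes a :: "'a::euclidean_space \<Rightarrow> real"
  assumes "open W" "times_cont_diff_on k a W" "times_cont_diff_on k f W"
  shows "times_cont_diff_on k (\<lambda>x. a x *\<^sub>R f x) W"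
  using assms(2,3)
proof (induction k arbitrary: a f)
  case (Suc k)
  have "times_cont_diff_on k a W" "times_cont_diff_on k f W"
    using Suc.prems times_cont_diff_on_lower by blast+
  moreover have "times_cont_diff_on k (\<lambda>x. frechet_derivative a (at x) v) W"
      "times_cont_diff_on k (\<lambda>x. frechet_derivative f (at x) v) W" for v
    using Suc.prems by auto
  ultimately show ?case
    by (intro times_cont_diff_on_SucI[OF assms(1)
          has_derivative_scaleR[OF times_cont_diff_on_derivative[OF Suc.prems(1)]
            times_cont_diff_on_derivative[OF Suc.prems(2)]]]
        times_cont_diff_on_add[OF assms(1)] Suc.IH Suc.prems)
qed (auto intro: continuous_intros)

lemma times_cont_diff_on_mult:
  fixes a b :: "'a::euclidean_space \<Rightarrow> real"
  shows "open W \<Longrightarrow> times_cont_diff_on k a W \<Longrightarrow> times_cont_diff_on k b W \<Longrightarrow>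
    times_cont_diff_on k (\<lambda>x. a x * b x) W"
  using times_cont_diff_on_scaleR[of W k a b] by simp

lemma times_cont_diff_on_sum:
  assumes "open W" "\<And>i. i \<in> I \<Longrightarrow> times_cont_diff_on k (f i) W"
  shows "times_cont_diff_on k (\<lambda>x. \<Sum>i\<in>I. f i x) W"
  using assms(2)
  by (induction I rule: infinite_finite_induct)
    (auto intro: times_cont_diff_on_const times_cont_diff_on_add assms(1))

lemma times_cont_diff_on_prod:
  fixes f :: "'i \<Rightarrow> 'a::euclidean_space \<Rightarrow> real"
  assumes "open W" "\<And>i. i \<in> I \<Longrightarrow> times_cont_diff_on k (f i) W"
  shows "times_cont_diff_on k (\<lambda>x. \<Prod>i\<in>I. f i x) W"
  using assms(2)
  by (induction I rule: infinite_finite_induct)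
    (auto intro: times_cont_diff_on_const times_cont_diff_on_mult assms(1))

lemma times_cont_diff_on_vec:
  fixes f :: "'a::euclidean_space \<Rightarrow> real ^ 'n"
  assumes "open W" "\<And>i. times_cont_diff_on k (\<lambda>x. f x $ i) W"
  shows "times_cont_diff_on k f W"
proof -
  have eq: "(\<Sum>i\<in>UNIV. f x $ i *\<^sub>R axis i (1::real)) = f x" for x
    by (auto simp: vec_eq_iff axis_def if_distrib cong: if_cong)
  have "times_cont_diff_on k (\<lambda>x. \<Sum>i\<in>UNIV. f x $ i *\<^sub>R axis i (1::real)) W"
    by (intro times_cont_diff_on_sum times_cont_diff_on_scaleR times_cont_diff_on_const assms)
  then show ?thesis
    by (rule times_cont_diff_on_cong[OF assms(1) eq])
qed

lemma times_cont_diff_on_inverse: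
  fixes a :: "'a::euclidean_space \<Rightarrow> real"
  assumes "open W" "times_cont_diff_on k a W" and nz: "\<And>x. x \<in> W \<Longrightarrow> a x \<noteq> 0"
  shows "times_cont_diff_on k (\<lambda>x. inverse (a x)) W"
  using assms(2)
proof (induction k)
  case 0
  then show ?case using nz by (auto intro: continuous_intros)
next
  case (Suc k)
  have "times_cont_diff_on k (\<lambda>x. inverse (a x)) W"
    using Suc times_cont_diff_on_lower by blast
  moreover have "times_cont_diff_on k (\<lambda>x. frechet_derivative a (at x) v) W" for v
    using Suc.prems by auto
  ultimately have "times_cont_diff_on k
      (\<lambda>x. - 1 * ((inverse (a x) * frechet_derivative a (at x) v) * inverse (a x))) W" for v
    by (intro times_cont_diff_on_mult times_cont_diff_on_const assms(1))
  then show ?case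
    by (intro times_cont_diff_on_SucI[OF assms(1),
          where f' = "\<lambda>x v. - (inverse (a x) * frechet_derivative a (at x) v * inverse (a x))"]
        Deriv.has_derivative_inverse times_cont_diff_on_derivative[OF Suc.prems] nz) auto
qed

text \<open>Induction on the order works because, in coordinates, the derivative of \<open>g \<circ> f\<close> in direction
  \<open>v\<close> is a sum of products of partial derivatives of \<open>g\<close>, composed with \<open>f\<close>, and coordinates of
  the derivative of \<open>f\<close>: the induction hypothesis, which is general in \<open>g\<close>, applies to each factor.\<close>

lemma times_cont_diff_on_compose:
  fixes f :: "'a::euclidean_space \<Rightarrow> 'b::euclidean_space" and g :: "'b \<Rightarrow> 'c::euclidean_space"
  assumes "open W" "f ` W \<subseteq> V" "times_cont_diff_on k f W" "times_cont_diff_on k g V"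
  shows "times_cont_diff_on k (\<lambda>x. g (f x)) W"
  using assms(3,4)
proof (induction k arbitrary: g)
  case 0
  then show ?case using assms(2) by (auto intro: continuous_on_compose2)
next
  case (Suc k)
  let ?Df = "\<lambda>x. frechet_derivative f (at x)"
  let ?Dg = "\<lambda>x. frechet_derivative g (at x)"
  have fk: "times_cont_diff_on k f W"
    using Suc.prems times_cont_diff_on_lower by blast
  have "((\<lambda>x. g (f x)) has_derivative (\<lambda>v. \<Sum>b\<in>Basis. (?Df x v \<bullet> b) *\<^sub>R ?Dg (f x) b)) (at x)"
    if "x \<in> W" for x
  proof -
    have g: "(g has_derivative ?Dg (f x)) (at (f x))"
      using assms(2) that by (blast intro: times_cont_diff_on_derivative[OF Suc.prems(2)])
    then interpret bounded_linear "?Dg (f x)" by (rule has_derivative_bounded_linear)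
    have "?Dg (f x) w = (\<Sum>b\<in>Basis. (w \<bullet> b) *\<^sub>R ?Dg (f x) b)" for w
      using sum[of "\<lambda>b. (w \<bullet> b) *\<^sub>R b" Basis] by (simp add: euclidean_representation scaleR)
    then have "(\<lambda>v. ?Dg (f x) (?Df x v)) = (\<lambda>v. \<Sum>b\<in>Basis. (?Df x v \<bullet> b) *\<^sub>R ?Dg (f x) b)"
      by blast
    then show ?thesis
      by (rule has_derivative_eq_rhs[OF has_derivative_compose[OF
            times_cont_diff_on_derivative[OF Suc.prems(1) that] g]])
  qed
  moreover have "times_cont_diff_on k (\<lambda>x. \<Sum>b\<in>Basis. (?Df x v \<bullet> b) *\<^sub>R ?Dg (f x) b) W" for v
    using Suc.prems
    by (intro times_cont_diff_on_sum times_cont_diff_on_scaleR assms(1) Suc.IH fk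
        times_cont_diff_on_linear_image[OF _ bounded_linear_inner_left]) auto
  ultimately show ?case
    by (rule times_cont_diff_on_SucI[OF assms(1)])
qed

lemma times_cont_diff_on_det:
  fixes M :: "'a::euclidean_space \<Rightarrow> real ^ 'n ^ 'n"
  assumes "open W" "\<And>i j. times_cont_diff_on k (\<lambda>x. M x $ i $ j) W"
  shows "times_cont_diff_on k (\<lambda>x. det (M x)) W"
  unfolding det_def
  by (intro times_cont_diff_on_sum times_cont_diff_on_mult times_cont_diff_on_const
      times_cont_diff_on_prod assms)

text \<open>The derivative of the inverse \<open>h\<close> at \<open>y\<close> is the inverse of the Jacobian matrix of \<open>g\<close> at
  \<open>h y\<close>. Cramer's rule writes it as a rational expression in the entries of that matrix, and these
  are compositions of derivatives of \<open>g\<close> with \<open>h\<close>. So if \<open>h\<close> is differentiable \<open>k\<close> times, its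
  derivative is too: smoothness of \<open>h\<close> climbs up to that of \<open>g\<close> one order at a time.\<close>

lemma times_cont_diff_on_inverse_function:
  fixes g :: "real ^ 'n \<Rightarrow> real ^ 'n"
  assumes "open W" "open V" and hom: "homeomorphism W V g h"
    and "times_cont_diff_on k g W"
    and nz: "\<And>x. x \<in> W \<Longrightarrow> det (matrix (frechet_derivative g (at x))) \<noteq> 0"
  shows "times_cont_diff_on k h V"
  using assms(4)
proof (induction k)
  case 0
  then show ?case using hom by (simp add: homeomorphism_def)
next
  case (Suc k)
  let ?M = "\<lambda>y. matrix (frechet_derivative g (at (h y)))"
  let ?D = "\<lambda>y v. \<chi> m. det (\<chi> i j. if j = m then v $ i else ?M y $ i $ j) / det (?M y)"
  have hV: "h ` V = W" and h: "times_cont_diff_on k h V"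
    using hom Suc times_cont_diff_on_lower by (auto simp: homeomorphism_def)
  have gh: "\<And>y. y \<in> V \<Longrightarrow> g (h y) = y" and hW: "\<And>y. y \<in> V \<Longrightarrow> h y \<in> W"
    using hom by (auto simp: homeomorphism_def)
  have "(h has_derivative ?D y) (at y)" if y: "y \<in> V" for y
  proof -
    let ?g' = "frechet_derivative g (at (h y))"
    have g': "(g has_derivative ?g') (at (h y))"
      using Suc.prems hW y by (intro times_cont_diff_on_derivative) auto
    then have lin: "linear ?g'"
      using has_derivative_linear by blast
    (* Keeping the explicit determinant formula folded keeps the linear algebra readable. *)
    define D where "D = ?D y"
    have "?M y *v x = v \<longleftrightarrow> x = D v" for x v
      unfolding D_def using cramer[OF nz[OF hW[OF y]]] by blast
    then have eq: "?g' x = v \<longleftrightarrow> x = D v" for x v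
      by (simp add: matrix_works lin)
    have "D (?g' x) = x" for x
      using eq[of x "?g' x"] by simp
    then have inv: "D \<circ> ?g' = id"
      by (simp add: fun_eq_iff)
    have "?g' (D v) = v" for v
      using eq by blast
    then have "?g' (D v + D w) = v + w" "?g' (c *\<^sub>R D v) = c *\<^sub>R v" for v w c
      by (simp_all add: linear_add[OF lin] linear_cmul[OF lin])
    then have "D (v + w) = D v + D w" "D (c *\<^sub>R v) = c *\<^sub>R D v" for v w c
      using eq by metis+
    then have "linear D"
      by (rule linearI)
    then have "(h has_derivative D) (at y)"
      using has_derivative_inverse_basic[OF g' _ inv _ assms(2) y gh] hom y assms(2)
      by (simp add: homeomorphism_def continuous_on_eq_continuous_at linear_conv_bounded_linear)
    then show ?thesis
      unfolding D_def .
  qed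
  moreover have "times_cont_diff_on k (\<lambda>y. ?D y v) V" for v
  proof -
    have M: "times_cont_diff_on k (\<lambda>y. ?M y $ i $ j) V" for i j
    proof -
      have "times_cont_diff_on k (\<lambda>y. frechet_derivative g (at (h y)) (axis j 1)) V"
        using times_cont_diff_on_compose[OF assms(2) _ h, of W "\<lambda>x. frechet_derivative g (at x) (axis j 1)"]
          hV Suc.prems by auto
      then show ?thesis
        using times_cont_diff_on_component[OF assms(2)] by (simp add: matrix_def)
    qed
    have "times_cont_diff_on k (\<lambda>y. (\<chi> i j. if j = m then v $ i else ?M y $ i $ j) $ i $ j) V" for i j m
      using M times_cont_diff_on_const[OF assms(2)] by (cases "j = m") auto
    then have "times_cont_diff_on k (\<lambda>y. det (\<chi> i j. if j = m then v $ i else ?M y $ i $ j)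
        * inverse (det (?M y))) V" for m
      using nz hW
      by (intro times_cont_diff_on_mult times_cont_diff_on_inverse times_cont_diff_on_det M assms(2)) auto
    then show ?thesis
      by (intro times_cont_diff_on_vec assms(2)) (simp add: divide_inverse)
  qed
  ultimately show ?case
    by (rule times_cont_diff_on_SucI[OF assms(2)])
qed

section \<open>Paths up to homotopy and the fundamental group\<close>

text \<open>The group laws for paths in an arbitrary topological space, where the constant path is a
  constant function and not a line segment.\<close>

lemma homotopic_paths_const_right:
  assumes "path p" "path_image p \<subseteq> S"
  shows "homotopic_paths S (p +++ (\<lambda>_. pathfinish p)) p"
proof -
  have "homotopic_paths S p (p +++ (\<lambda>_. pathfinish p))"
  proof (rule homotopic_paths_reparametrize[OF assms, where f = "\<lambda>t. min (2 * t) 1"])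
    show "continuous_on {0..1} (\<lambda>t::real. min (2 * t) 1)"
      by (intro continuous_intros)
  qed (auto simp: joinpaths_def pathfinish_def min_def)
  then show ?thesis by (rule homotopic_paths_sym)
qed

lemma homotopic_paths_const_left:
  assumes "path p" "path_image p \<subseteq> S"
  shows "homotopic_paths S ((\<lambda>_. pathstart p) +++ p) p"
proof -
  have "homotopic_paths S p ((\<lambda>_. pathstart p) +++ p)"
  proof (rule homotopic_paths_reparametrize[OF assms, where f = "\<lambda>t. max 0 (2 * t - 1)"])
    show "continuous_on {0..1} (\<lambda>t::real. max 0 (2 * t - 1))"
      by (intro continuous_intros)
  qed (auto simp: joinpaths_def pathstart_def max_def intro!: arg_cong[of _ _ p])
  then show ?thesis by (rule homotopic_paths_sym)
qed

text \<open>The tent function \<open>1 - \<bar>2 * t - 1\<bar>\<close> traverses the unit interval and comes back, so \<open>p\<close> followed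
  by its reverse is \<open>p\<close> composed with the tent; shrinking the tent to zero is the homotopy.\<close>

lemma homotopic_paths_reversepath_right:
  assumes p: "path p" "path_image p \<subseteq> S"
  shows "homotopic_paths S (p +++ reversepath p) (\<lambda>_. pathstart p)"
proof -
  let ?h = "\<lambda>z. p ((1 - fst z) * (1 - \<bar>2 * snd z - 1\<bar>))"
  have range: "0 \<le> (1 - s) * (1 - \<bar>2 * t - 1\<bar>)" "(1 - s) * (1 - \<bar>2 * t - 1\<bar>) \<le> 1"
    if "s \<in> {0..1}" "t \<in> {0..1}" for s t :: real
    using that by (auto intro!: mult_nonneg_nonneg mult_le_one)
  have "continuous_on ({0..1} \<times> {0..1}) ?h"
    using range by (intro continuous_on_compose2[OF p(1)[unfolded path_def]] continuous_intros) auto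
  moreover have "?h ` ({0..1} \<times> {0..1}) \<subseteq> S"
    using p(2) range by (auto simp: path_image_def)
  moreover have "p (1 - \<bar>2 * t - 1\<bar>) = (p +++ reversepath p) t" for t
    by (auto simp: joinpaths_def reversepath_def abs_if intro!: arg_cong[of _ _ p])
  ultimately show ?thesis
    unfolding homotopic_paths image_subset_iff_funcset[symmetric]
    by (intro exI[of _ ?h]) (auto simp: pathstart_def pathfinish_def joinpaths_def reversepath_def)
qed

lemma homotopic_paths_reversepath_left:
  assumes "path p" "path_image p \<subseteq> S"
  shows "homotopic_paths S (reversepath p +++ p) (\<lambda>_. pathfinish p)"
  using homotopic_paths_reversepath_right[of "reversepath p" S] assms by simp

definition path_in :: "'a::topological_space set \<Rightarrow> (real \<Rightarrow> 'a) \<Rightarrow> 'a \<Rightarrow> 'a \<Rightarrow> bool" where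
  "path_in S p a b \<longleftrightarrow> path p \<and> path_image p \<subseteq> S \<and> pathstart p = a \<and> pathfinish p = b"

lemma path_in_join: "path_in S p a b \<Longrightarrow> path_in S q b c \<Longrightarrow> path_in S (p +++ q) a c"
  by (auto simp: path_in_def path_join_imp path_image_join)

lemma path_in_reverse: "path_in S p a b \<Longrightarrow> path_in S (reversepath p) b a"
  by (auto simp: path_in_def)

lemma path_in_refl: "path_in S p a b \<Longrightarrow> homotopic_paths S p p"
  by (auto simp: path_in_def)

lemma path_in_const: "a \<in> S \<Longrightarrow> path_in S (\<lambda>_. a) a a"
  by (auto simp: path_in_def path_def path_image_def pathstart_def pathfinish_def)

lemma loops_at_eq_path_in: "p \<in> loops_at S a \<longleftrightarrow> path_in S p a a"
  by (auto simp: loops_at_def path_in_def)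

lemma homotopic_paths_join_in:
  "homotopic_paths S p p' \<Longrightarrow> homotopic_paths S q q' \<Longrightarrow> path_in S p a b \<Longrightarrow> path_in S q b c \<Longrightarrow>
     homotopic_paths S (p +++ q) (p' +++ q')"
  by (auto simp: path_in_def intro: homotopic_paths_join)

text \<open>For a loop this is an element of the fundamental group. Admitting arbitrary paths makes the
  groupoid structure available, in which change of basepoint is conjugation by a path.\<close>

definition path_class :: "'a::topological_space set \<Rightarrow> (real \<Rightarrow> 'a) \<Rightarrow> (real \<Rightarrow> 'a) set" where
  "path_class S p = {q. homotopic_paths S p q}"

definition class_mult :: "'a::topological_space set \<Rightarrow> (real \<Rightarrow> 'a) set \<Rightarrow> (real \<Rightarrow> 'a) set \<Rightarrow> (real \<Rightarrow> 'a) set" where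
  "class_mult S P Q = {r. \<exists>p\<in>P. \<exists>q\<in>Q. homotopic_paths S (p +++ q) r}"

lemma path_class_eq:
  "path_in S p a b \<Longrightarrow> path_class S p = path_class S q \<longleftrightarrow> homotopic_paths S p q"
  unfolding path_class_def path_in_def
  by (metis (mono_tags, lifting) Collect_cong homotopic_paths_refl homotopic_paths_sym
      homotopic_paths_trans mem_Collect_eq)

lemma class_mult_path_class:
  assumes "path_in S p a b" "path_in S q b c"
  shows "class_mult S (path_class S p) (path_class S q) = path_class S (p +++ q)"
proof -
  have "homotopic_paths S p p" "homotopic_paths S q q"
    using assms by (auto simp: path_in_def)
  moreover have "homotopic_paths S (p +++ q) (p' +++ q')"
    if "homotopic_paths S p p'" "homotopic_paths S q q'" for p' q'
    using homotopic_paths_join_in[OF that assms] .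
  ultimately show ?thesis
    unfolding class_mult_def path_class_def by (blast intro: homotopic_paths_trans)
qed

lemma path_class_assoc:
  assumes "path_in S p a b" "path_in S q b c" "path_in S r c d"
  shows "path_class S ((p +++ q) +++ r) = path_class S (p +++ (q +++ r))"
  unfolding path_class_eq[OF path_in_join[OF path_in_join[OF assms(1,2)] assms(3)]]
  by (rule homotopic_paths_sym, rule homotopic_paths_assoc) (use assms in \<open>auto simp: path_in_def\<close>)

text \<open>Cancellation for classes of paths. With associativity it turns the computations about conjugation
  by a path into chains of equations between classes.\<close>

lemma path_class_cancel:
  assumes p: "path_in S p a b"
  shows "path_in S q b c \<Longrightarrow> path_class S (reversepath p +++ (p +++ q)) = path_class S q"
    and "path_in S q a c \<Longrightarrow> path_class S (p +++ (reversepath p +++ q)) = path_class S q"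
proof -
  have *: "path_class S (reversepath p +++ (p +++ q)) = path_class S q"
    if p: "path_in S p a b" and q: "path_in S q b c" for p q a b c
  proof -
    have "path_class S ((reversepath p +++ p) +++ q) = path_class S ((\<lambda>_. b) +++ q)"
      using homotopic_paths_reversepath_left[of p S] p q
      by (subst path_class_eq[OF path_in_join[OF path_in_join[OF path_in_reverse[OF p] p] q]])
       (auto simp: path_in_def intro: homotopic_paths_join)
    also have "\<dots> = path_class S q"
    proof (subst path_class_eq)
      have "b \<in> S" using p unfolding path_in_def by (metis pathfinish_in_path_image subsetD)
      then show "path_in S ((\<lambda>_. b) +++ q) b c" using path_in_const path_in_join q by blast
      show "homotopic_paths S ((\<lambda>_. b) +++ q) q"
        using homotopic_paths_const_left[of q S] q by (auto simp: path_in_def)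
    qed
    finally show ?thesis
      using path_class_assoc[OF path_in_reverse[OF p] p q] by simp
  qed
  show "path_in S q b c \<Longrightarrow> path_class S (reversepath p +++ (p +++ q)) = path_class S q"
    using *[OF p] .
  show "path_in S q a c \<Longrightarrow> path_class S (p +++ (reversepath p +++ q)) = path_class S q"
    using *[OF path_in_reverse[OF p]] by simp
qed

lemma carrier_fundamental_group:
  "carrier (fundamental_group S a) = path_class S ` loops_at S a"
  by (auto simp: fundamental_group_def path_class_def quotient_def)

lemma mult_fundamental_group:
  "mult (fundamental_group S a) = class_mult S"
  by (auto simp: fundamental_group_def class_mult_def fun_eq_iff)

lemma one_fundamental_group:
  "one (fundamental_group S a) = path_class S (\<lambda>_. a)"
  by (auto simp: fundamental_group_def path_class_def)

lemma class_mult_in: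
  assumes "path_in S p a a" "path_in S q a a"
  shows "path_class S p \<otimes>\<^bsub>fundamental_group S a\<^esub> path_class S q = path_class S (p +++ q)"
  using class_mult_path_class[OF assms] by (simp add: mult_fundamental_group)

lemma group_fundamental_group:
  assumes "a \<in> S"
  shows "group (fundamental_group S a)"
proof (rule groupI)
  let ?G = "fundamental_group S a"
  have carrierE: "\<exists>p. path_in S p a a \<and> P = path_class S p" if "P \<in> carrier ?G" for P
    using that by (auto simp: carrier_fundamental_group loops_at_eq_path_in)
  have carrierI: "path_class S p \<in> carrier ?G" if "path_in S p a a" for p
    using that by (auto simp: carrier_fundamental_group loops_at_eq_path_in)
  note const = path_in_const[OF assms]
  show "\<one>\<^bsub>?G\<^esub> \<in> carrier ?G"
    unfolding one_fundamental_group by (rule carrierI[OF const])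
  fix P assume P: "P \<in> carrier ?G"
  obtain p where p: "path_in S p a a" and Pp: "P = path_class S p" using carrierE[OF P] by blast
  show "\<one>\<^bsub>?G\<^esub> \<otimes>\<^bsub>?G\<^esub> P = P"
    unfolding Pp one_fundamental_group class_mult_in[OF const p] path_class_eq[OF path_in_join[OF const p]]
    using homotopic_paths_const_left[of p S] p by (auto simp: path_in_def)
  have "path_class S (reversepath p) \<otimes>\<^bsub>?G\<^esub> P = \<one>\<^bsub>?G\<^esub>"
    unfolding Pp one_fundamental_group class_mult_in[OF path_in_reverse[OF p] p]
      path_class_eq[OF path_in_join[OF path_in_reverse[OF p] p]]
    using homotopic_paths_reversepath_left[of p S] p by (auto simp: path_in_def)
  then show "\<exists>Q\<in>carrier ?G. Q \<otimes>\<^bsub>?G\<^esub> P = \<one>\<^bsub>?G\<^esub>"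
    using carrierI[OF path_in_reverse[OF p]] by blast
  fix Q assume Q: "Q \<in> carrier ?G"
  obtain q where q: "path_in S q a a" and Qq: "Q = path_class S q" using carrierE[OF Q] by blast
  show "P \<otimes>\<^bsub>?G\<^esub> Q \<in> carrier ?G"
    unfolding Pp Qq class_mult_in[OF p q] by (rule carrierI[OF path_in_join[OF p q]])
  fix R assume R: "R \<in> carrier ?G"
  obtain r where r: "path_in S r a a" and Rr: "R = path_class S r" using carrierE[OF R] by blast
  show "P \<otimes>\<^bsub>?G\<^esub> Q \<otimes>\<^bsub>?G\<^esub> R = P \<otimes>\<^bsub>?G\<^esub> (Q \<otimes>\<^bsub>?G\<^esub> R)"
    unfolding Pp Qq Rr
    by (simp only: class_mult_in[OF p q] class_mult_in[OF q r] class_mult_in[OF path_in_join[OF p q] r]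
        class_mult_in[OF p path_in_join[OF q r]] path_class_assoc[OF p q r])
qed

lemma path_class_join_cong:
  assumes "path_class S p = path_class S p'" "path_class S q = path_class S q'"
    and "path_in S p a b" "path_in S q b c"
  shows "path_class S (p +++ q) = path_class S (p' +++ q')"
  using assms homotopic_paths_join_in path_class_eq path_in_join by metis

text \<open>An operation \<open>F\<close> on loops acts on homotopy classes; when \<open>F\<close> respects homotopy this is the
  class of the image of any representative. No representative is chosen, exactly as in the
  multiplication of the fundamental group.\<close>

definition induced :: "'b::topological_space set \<Rightarrow> ((real \<Rightarrow> 'a) \<Rightarrow> real \<Rightarrow> 'b) \<Rightarrow> (real \<Rightarrow> 'a) set \<Rightarrow> (real \<Rightarrow> 'b) set" where
  "induced T F P = {r. \<exists>p\<in>P. homotopic_paths T (F p) r}"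

lemma induced_path_class:
  assumes "path_in S p a b"
    and F: "\<And>q. homotopic_paths S p q \<Longrightarrow> homotopic_paths T (F p) (F q)"
  shows "induced T F (path_class S p) = path_class T (F p)"
proof -
  have "homotopic_paths S p p" using assms(1) by (auto simp: path_in_def)
  then show ?thesis
    unfolding induced_def path_class_def using F by (blast intro: homotopic_paths_trans)
qed

lemma induced_hom:
  assumes F: "\<And>p. path_in S p a a \<Longrightarrow> path_in T (F p) b b"
    and FH: "\<And>p q. homotopic_paths S p q \<Longrightarrow> path_in S p a a \<Longrightarrow> homotopic_paths T (F p) (F q)"
    and FM: "\<And>p q. path_in S p a a \<Longrightarrow> path_in S q a a \<Longrightarrow> 
       path_class T (F (p +++ q)) = path_class T (F p +++ F q)"
  shows "induced T F \<in> hom (fundamental_group S a) (fundamental_group T b)"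
proof (rule homI)
  let ?G = "fundamental_group S a" and ?H = "fundamental_group T b"
  have ind: "induced T F (path_class S p) = path_class T (F p)" if "path_in S p a a" for p
    using induced_path_class[OF that] FH that by blast
  fix P assume "P \<in> carrier ?G"
  then obtain p where p: "path_in S p a a" and P: "P = path_class S p"
    by (auto simp: carrier_fundamental_group loops_at_eq_path_in)
  show "induced T F P \<in> carrier ?H"
    using F[OF p] by (auto simp: P ind[OF p] carrier_fundamental_group loops_at_eq_path_in)
  fix Q assume "Q \<in> carrier ?G"
  then obtain q where q: "path_in S q a a" and Q: "Q = path_class S q"
    by (auto simp: carrier_fundamental_group loops_at_eq_path_in)
  show "induced T F (P \<otimes>\<^bsub>?G\<^esub> Q) = induced T F P \<otimes>\<^bsub>?H\<^esub> induced T F Q"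
    unfolding P Q class_mult_in[OF p q] ind[OF p] ind[OF q] ind[OF path_in_join[OF p q]]
      class_mult_in[OF F[OF p] F[OF q]]
    by (rule FM[OF p q])
qed

text \<open>Conjugation by a path from \<open>a\<close> to \<open>b\<close>; conjugation by the reversed path undoes it.\<close>

lemma fundamental_group_basepoint_iso:
  assumes \<alpha>: "path_in S \<alpha> a b"
  shows "fundamental_group S b \<cong> fundamental_group S a"
proof -
  let ?F = "\<lambda>p. \<alpha> +++ (p +++ reversepath \<alpha>)"
  note r\<alpha> = path_in_reverse[OF \<alpha>]
  have F: "path_in S (?F p) a a" if "path_in S p b b" for p
    using that \<alpha> r\<alpha> path_in_join by metis
  have FH: "homotopic_paths S (?F p) (?F q)" if "homotopic_paths S p q" "path_in S p b b" for p q
    by (intro homotopic_paths_join_in[OF _ _ \<alpha> path_in_join[OF that(2) r\<alpha>]]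
        homotopic_paths_join_in[OF that(1) _ that(2) r\<alpha>] path_in_refl[OF \<alpha>] path_in_refl[OF r\<alpha>])
  have FM: "path_class S (?F (p +++ q)) = path_class S (?F p +++ ?F q)"
    if p: "path_in S p b b" and q: "path_in S q b b" for p q
  proof -
    let ?w = "q +++ reversepath \<alpha>"
    have w: "path_in S ?w b a" using q r\<alpha> path_in_join by metis
    have pr: "path_in S (p +++ reversepath \<alpha>) b a" using p r\<alpha> path_in_join by metis
    have "path_class S (?F p +++ ?F q) = path_class S (\<alpha> +++ ((p +++ reversepath \<alpha>) +++ (\<alpha> +++ ?w)))"
      by (rule path_class_assoc[OF \<alpha> pr F[OF q]])
    also have "\<dots> = path_class S (\<alpha> +++ (p +++ ?w))"
    proof (rule path_class_join_cong[OF refl _ \<alpha>])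
      show "path_in S ((p +++ reversepath \<alpha>) +++ (\<alpha> +++ ?w)) b a"
        using pr \<alpha> w path_in_join by metis
      have "path_class S ((p +++ reversepath \<alpha>) +++ (\<alpha> +++ ?w))
          = path_class S (p +++ (reversepath \<alpha> +++ (\<alpha> +++ ?w)))"
        by (rule path_class_assoc[OF p r\<alpha> path_in_join[OF \<alpha> w]])
      also have "\<dots> = path_class S (p +++ ?w)"
        by (rule path_class_join_cong[OF refl path_class_cancel(1)[OF \<alpha> w] p
              path_in_join[OF r\<alpha> path_in_join[OF \<alpha> w]]])
      finally show "path_class S ((p +++ reversepath \<alpha>) +++ (\<alpha> +++ ?w)) = path_class S (p +++ ?w)" .
    qed
    also have "\<dots> = path_class S (?F (p +++ q))"
      by (rule path_class_join_cong[OF refl path_class_assoc[OF p q r\<alpha>, symmetric] \<alpha> path_in_join[OF p w]])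
    finally show ?thesis ..
  qed
  have inv: "path_class S (reversepath \<alpha> +++ (?F p +++ \<alpha>)) = path_class S p" if p: "path_in S p b b" for p
  proof -
    have pr: "path_in S (p +++ reversepath \<alpha>) b a" using p r\<alpha> path_in_join by metis
    have "path_class S (reversepath \<alpha> +++ (?F p +++ \<alpha>))
        = path_class S (reversepath \<alpha> +++ (\<alpha> +++ ((p +++ reversepath \<alpha>) +++ \<alpha>)))"
      by (rule path_class_join_cong[OF refl path_class_assoc[OF \<alpha> pr \<alpha>] r\<alpha> path_in_join[OF F[OF p] \<alpha>]])
    also have "\<dots> = path_class S ((p +++ reversepath \<alpha>) +++ \<alpha>)"
      by (rule path_class_cancel(1)[OF \<alpha> path_in_join[OF pr \<alpha>]])
    also have "\<dots> = path_class S (p +++ (reversepath \<alpha> +++ \<alpha>))"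
      by (rule path_class_assoc[OF p r\<alpha> \<alpha>])
    also have "\<dots> = path_class S (p +++ (\<lambda>_. b))"
      using homotopic_paths_reversepath_left[of \<alpha> S] \<alpha>
      by (intro path_class_join_cong[OF refl _ p path_in_join[OF r\<alpha> \<alpha>]])
        (auto simp: path_class_eq[OF path_in_join[OF r\<alpha> \<alpha>]] path_in_def)
    also have "\<dots> = path_class S p"
    proof -
      have "homotopic_paths S (p +++ (\<lambda>_. b)) p"
        using homotopic_paths_const_right[of p S] p by (auto simp: path_in_def)
      then show ?thesis
        using path_class_eq[OF p] homotopic_paths_sym by metis
    qed
    finally show ?thesis .
  qed
  have ind: "induced S ?F (path_class S p) = path_class S (?F p)" if "path_in S p b b" for p
    by (rule induced_path_class[OF that]) (use FH that in blast)
  have "bij_betw (induced S ?F) (carrier (fundamental_group S b)) (carrier (fundamental_group S a))"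
  proof (rule bij_betw_imageI)
    show "inj_on (induced S ?F) (carrier (fundamental_group S b))"
    proof (rule inj_onI)
      fix P Q assume PQ: "P \<in> carrier (fundamental_group S b)" "Q \<in> carrier (fundamental_group S b)"
        "induced S ?F P = induced S ?F Q"
      then obtain p q where p: "path_in S p b b" "P = path_class S p"
        and q: "path_in S q b b" "Q = path_class S q"
        by (auto simp: carrier_fundamental_group loops_at_eq_path_in)
      have eq: "path_class S (?F p) = path_class S (?F q)"
        using PQ(3) p q ind by metis
      have "path_class S (reversepath \<alpha> +++ (?F p +++ \<alpha>)) = path_class S (reversepath \<alpha> +++ (?F q +++ \<alpha>))"
        by (intro path_class_join_cong[OF refl _ r\<alpha> path_in_join[OF F[OF p(1)] \<alpha>]]
            path_class_join_cong[OF eq refl F[OF p(1)] \<alpha>])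
      then show "P = Q"
        using inv p q by metis
    qed
    have "path_class S l \<in> induced S ?F ` carrier (fundamental_group S b)" if l: "path_in S l a a" for l
    proof -
      let ?p = "reversepath \<alpha> +++ (l +++ \<alpha>)"
      have l\<alpha>: "path_in S (l +++ \<alpha>) a b" using l \<alpha> path_in_join by metis
      have p: "path_in S ?p b b" using l\<alpha> r\<alpha> path_in_join by metis
      have "path_class S (?F ?p) = path_class S (\<alpha> +++ (reversepath \<alpha> +++ ((l +++ \<alpha>) +++ reversepath \<alpha>)))"
        by (rule path_class_join_cong[OF refl path_class_assoc[OF r\<alpha> l\<alpha> r\<alpha>] \<alpha> path_in_join[OF p r\<alpha>]])
      also have "\<dots> = path_class S ((l +++ \<alpha>) +++ reversepath \<alpha>)"
        by (rule path_class_cancel(2)[OF \<alpha> path_in_join[OF l\<alpha> r\<alpha>]])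
      also have "\<dots> = path_class S (l +++ (\<alpha> +++ reversepath \<alpha>))"
        by (rule path_class_assoc[OF l \<alpha> r\<alpha>])
      also have "\<dots> = path_class S (l +++ (\<lambda>_. a))"
        using homotopic_paths_reversepath_right[of \<alpha> S] \<alpha>
        by (intro path_class_join_cong[OF refl _ l path_in_join[OF \<alpha> r\<alpha>]])
          (auto simp: path_class_eq[OF path_in_join[OF \<alpha> r\<alpha>]] path_in_def)
      also have "\<dots> = path_class S l"
      proof -
        have "homotopic_paths S (l +++ (\<lambda>_. a)) l"
          using homotopic_paths_const_right[of l S] l by (auto simp: path_in_def)
        then show ?thesis
          using path_class_eq[OF l] homotopic_paths_sym by metis
      qed
      finally have "induced S ?F (path_class S ?p) = path_class S l"
        using ind[OF p] by simp
      moreover have "path_class S ?p \<in> carrier (fundamental_group S b)"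
        using p by (auto simp: carrier_fundamental_group loops_at_eq_path_in)
      ultimately show ?thesis by (metis imageI)
    qed
    moreover have "induced S ?F ` carrier (fundamental_group S b) \<subseteq> carrier (fundamental_group S a)"
      using induced_hom[OF F FH FM] by (auto simp: hom_def)
    ultimately show "induced S ?F ` carrier (fundamental_group S b) = carrier (fundamental_group S a)"
      by (auto simp: carrier_fundamental_group loops_at_eq_path_in)
  qed
  then show ?thesis
    using induced_hom[OF F FH FM] by (auto simp: is_iso_def iso_def)
qed

section \<open>Lifting paths and homotopies\<close>

text \<open>The lift may be prescribed at an arbitrary point of \<open>K\<close>. This freedom is what makes the property
  pass to unions of two pieces, since the second lift has to start wherever the first one arrives.\<close>

definition has_lifts :: "'a::topological_space set \<Rightarrow> ('a \<Rightarrow> 'b) \<Rightarrow> ('c::topological_space \<Rightarrow> 'b) \<Rightarrow> 'c set \<Rightarrow> bool" where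
  "has_lifts X f h K \<longleftrightarrow>
     (\<forall>k\<in>K. \<forall>x\<in>X. f x = h k \<longrightarrow>
        (\<exists>g. continuous_on K g \<and> g ` K \<subseteq> X \<and> (\<forall>z\<in>K. f (g z) = h z) \<and> g k = x))"

text \<open>Instead of a decomposition of the preimage of \<open>V\<close> into disjoint sheets, the last assumption
  provides a section over \<open>V\<close> through each point above \<open>V\<close>. Sections yield existence of local
  lifts, local injectivity yields their uniqueness, and sections are easy to produce for a local
  homeomorphism.\<close>

locale covering_projection =
  fixes X :: "'a::topological_space set" and Y :: "'b::topological_space set" and f :: "'a \<Rightarrow> 'b"
  assumes hausdorff: "Hausdorff_space (top_of_set X)"
    and continuous: "continuous_on X f"
    and maps_into: "f ` X \<subseteq> Y"
    and locally_injective: "\<And>x. x \<in> X \<Longrightarrow> \<exists>U. openin (top_of_set X) U \<and> x \<in> U \<and> inj_on f U"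
    and local_sections: "\<And>y. y \<in> Y \<Longrightarrow> \<exists>V. openin (top_of_set Y) V \<and> y \<in> V \<and>
          (\<forall>x\<in>X. f x \<in> V \<longrightarrow>
            (\<exists>s. continuous_on V s \<and> s ` V \<subseteq> X \<and> (\<forall>z\<in>V. f (s z) = z) \<and> s (f x) = x))"
begin

text \<open>The set on which two lifts agree is closed because \<open>X\<close> is Hausdorff and open because \<open>f\<close> is
  locally injective.\<close>

lemma lift_unique:
  fixes K :: "'c::topological_space set"
  assumes "connected K" and g1: "continuous_on K g1" "g1 ` K \<subseteq> X"
    and g2: "continuous_on K g2" "g2 ` K \<subseteq> X"
    and eq: "\<And>z. z \<in> K \<Longrightarrow> f (g1 z) = f (g2 z)"
    and "k \<in> K" "g1 k = g2 k" "z \<in> K"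
  shows "g1 z = g2 z"
proof -
  let ?E = "{z \<in> K. g1 z = g2 z}"
  have "closedin (top_of_set K) ?E"
    using closedin_continuous_maps_eq[of "top_of_set X" "top_of_set K" g1 g2] hausdorff g1 g2 by auto
  moreover have "openin (top_of_set K) ?E"
  proof (subst openin_subopen, intro ballI)
    fix z assume z: "z \<in> ?E"
    then obtain U where U: "openin (top_of_set X) U" "g1 z \<in> U" "inj_on f U"
      using locally_injective g1(2) by blast
    have "openin (top_of_set K) (K \<inter> g1 -` U \<inter> (K \<inter> g2 -` U))"
      using g1 g2 U(1) by (intro openin_Int continuous_openin_preimage[of _ _ X]) auto
    moreover have "K \<inter> g1 -` U \<inter> (K \<inter> g2 -` U) \<subseteq> ?E"
      using U(3) eq by (auto simp: inj_on_def)
    ultimately show "\<exists>T. openin (top_of_set K) T \<and> z \<in> T \<and> T \<subseteq> ?E"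
      using z U(2) by (intro exI[of _ "K \<inter> g1 -` U \<inter> (K \<inter> g2 -` U)"]) auto
  qed
  ultimately have "?E = K"
    using assms(1,7,8) unfolding connected_clopen by blast
  then show ?thesis using \<open>z \<in> K\<close> by blast
qed

lemma has_lifts_section:
  assumes h: "continuous_on K h" and hV: "h ` K \<subseteq> V"
    and V: "\<forall>x\<in>X. f x \<in> V \<longrightarrow>
            (\<exists>s. continuous_on V s \<and> s ` V \<subseteq> X \<and> (\<forall>z\<in>V. f (s z) = z) \<and> s (f x) = x)"
  shows "has_lifts X f h K"
  unfolding has_lifts_def
proof (intro ballI impI)
  fix k x assume k: "k \<in> K" and x: "x \<in> X" "f x = h k"
  then obtain s where s: "continuous_on V s" "s ` V \<subseteq> X" "\<forall>z\<in>V. f (s z) = z" "s (f x) = x"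
    using V hV by (metis imageI subsetD)
  then show "\<exists>g. continuous_on K g \<and> g ` K \<subseteq> X \<and> (\<forall>z\<in>K. f (g z) = h z) \<and> g k = x"
    using h hV x by (intro exI[of _ "\<lambda>z. s (h z)"] conjI continuous_on_compose2[OF s(1) h])
      (auto simp: image_subset_iff)
qed

text \<open>Lift over one piece, continue over the other from a common point, and glue: on the connected
  intersection the two lifts coincide by uniqueness.\<close>

lemma has_lifts_Un:
  fixes K L :: "'c::topological_space set"
  assumes K: "has_lifts X f h K" "closed K" and L: "has_lifts X f h L" "closed L"
    and KL: "connected (K \<inter> L)" "K \<inter> L \<noteq> {}"
  shows "has_lifts X f h (K \<union> L)"
proof -
  have *: "\<exists>g. continuous_on (K \<union> L) g \<and> g ` (K \<union> L) \<subseteq> X \<and> (\<forall>z\<in>K \<union> L. f (g z) = h z) \<and> g k = x"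
    if K: "has_lifts X f h K" "closed K" and L: "has_lifts X f h L" "closed L"
      and KL: "connected (K \<inter> L)" "K \<inter> L \<noteq> {}"
      and k: "k \<in> K" "x \<in> X" "f x = h k" for K L :: "'c set" and k x
  proof -
    obtain g1 where g1: "continuous_on K g1" "g1 ` K \<subseteq> X" "\<forall>z\<in>K. f (g1 z) = h z" "g1 k = x"
      using K k unfolding has_lifts_def by meson
    obtain m where m: "m \<in> K" "m \<in> L"
      using KL by blast
    then have "g1 m \<in> X" "f (g1 m) = h m"
      using g1 by blast+
    with m L(1) obtain g2
      where g2: "continuous_on L g2" "g2 ` L \<subseteq> X" "\<forall>z\<in>L. f (g2 z) = h z" "g2 m = g1 m"
      unfolding has_lifts_def by meson
    have agree: "g1 z = g2 z" if "z \<in> K \<inter> L" for z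
      using lift_unique[OF KL(1), of g1 g2 m z] g1 g2 m that
      by (auto intro: continuous_on_subset)
    let ?g = "\<lambda>z. if z \<in> K then g1 z else g2 z"
    have "continuous_on (K \<union> L) ?g"
      using agree by (intro continuous_on_cases K L g1 g2) auto
    moreover have "?g ` (K \<union> L) \<subseteq> X" "\<forall>z\<in>K \<union> L. f (?g z) = h z" "?g k = x"
      using g1 g2 k(1) by auto
    ultimately show ?thesis by blast
  qed
  show ?thesis
    unfolding has_lifts_def
  proof (intro ballI impI)
    fix k x assume k: "k \<in> K \<union> L" "x \<in> X" "f x = h k"
    have "\<exists>g. continuous_on (L \<union> K) g \<and> g ` (L \<union> K) \<subseteq> X \<and> (\<forall>z\<in>L \<union> K. f (g z) = h z) \<and> g k = x"
      if "k \<in> L"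
      using *[OF L K _ _ that k(2,3)] KL by (simp add: Int_commute)
    then show "\<exists>g. continuous_on (K \<union> L) g \<and> g ` (K \<union> L) \<subseteq> X \<and> (\<forall>z\<in>K \<union> L. f (g z) = h z) \<and> g k = x"
      using *[OF K L KL _ k(2,3)] k(1) by (auto simp: Un_commute)
  qed
qed

text \<open>Small rectangles have lifts because \<open>h\<close> sends them into a set carrying sections. Bisection in the
  second coordinate extends this to a thin vertical strip around any abscissa \<open>s\<close>, and bisection in
  the first coordinate to the whole square. Neighbouring rectangles meet in a segment, so they can be
  glued.\<close>

lemma has_lifts_square:
  fixes h :: "real \<times> real \<Rightarrow> 'b"
  assumes h: "continuous_on ({0..1} \<times> {0..1}) h" "h ` ({0..1} \<times> {0..1}) \<subseteq> Y"
  shows "has_lifts X f h ({0..1} \<times> {0..1})"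
proof -
  let ?Q = "{0..1::real} \<times> {0..1::real}"
  have nbhd: "\<exists>e>0. \<forall>K \<subseteq> ?Q \<inter> ({s-e..s+e} \<times> {t-e..t+e}). has_lifts X f h K"
    if st: "s \<in> {0..1}" "t \<in> {0..1}" for s t
  proof -
    have "h (s, t) \<in> Y" using h(2) st by blast
    then obtain V where V: "openin (top_of_set Y) V" "h (s, t) \<in> V"
      "\<forall>x\<in>X. f x \<in> V \<longrightarrow>
            (\<exists>s. continuous_on V s \<and> s ` V \<subseteq> X \<and> (\<forall>z\<in>V. f (s z) = z) \<and> s (f x) = x)"
      using local_sections by meson
    have "openin (top_of_set ?Q) (?Q \<inter> h -` V)"
      using h V(1) by (intro continuous_openin_preimage[of _ _ Y]) auto
    then obtain O' where O': "open O'" "?Q \<inter> h -` V = ?Q \<inter> O'"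
      by (auto simp: openin_open)
    have "(s, t) \<in> O'" using O'(2) st V(2) by auto
    then obtain A B where AB: "open A" "open B" "(s, t) \<in> A \<times> B" "A \<times> B \<subseteq> O'"
      by (rule open_prod_elim[OF O'(1)])
    obtain d1 where d1: "d1 > 0" "cball s d1 \<subseteq> A"
      using AB by (meson open_contains_cball mem_Sigma_iff)
    obtain d2 where d2: "d2 > 0" "cball t d2 \<subseteq> B"
      using AB by (meson open_contains_cball mem_Sigma_iff)
    have "has_lifts X f h K" if "K \<subseteq> ?Q \<inter> ({s - min d1 d2..s + min d1 d2} \<times> {t - min d1 d2..t + min d1 d2})" for K
    proof (rule has_lifts_section[OF _ _ V(3)])
      have "{s - min d1 d2..s + min d1 d2} \<subseteq> A" "{t - min d1 d2..t + min d1 d2} \<subseteq> B"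
        using d1(2) d2(2) unfolding cball_eq_atLeastAtMost
        by (meson atLeastatMost_subset_iff diff_left_mono add_left_mono min.cobounded1
            min.cobounded2 order_trans)+
      then have "{s - min d1 d2..s + min d1 d2} \<times> {t - min d1 d2..t + min d1 d2} \<subseteq> O'"
        using AB(4) by blast
      then have "K \<subseteq> ?Q \<inter> O'"
        using that by blast
      then show "h ` K \<subseteq> V" using O'(2) by blast
      show "continuous_on K h" using h(1) that by (auto intro: continuous_on_subset)
    qed
    then show ?thesis
      using d1(1) d2(1) by (intro exI[of _ "min d1 d2"]) auto
  qed
  have strip: "\<exists>e>0. \<forall>a b. a \<le> s \<and> s \<le> b \<and> b - a < e \<longrightarrow> has_lifts X f h (({0..1} \<inter> {a..b}) \<times> {0..1})"
    if s: "s \<in> {0..1}" for s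
  proof -
    (* The width e of the strip may depend on the height interval; gluing takes a minimum. *)
    define P where "P c d \<longleftrightarrow> 0 \<le> c \<and> d \<le> 1 \<longrightarrow> (\<exists>e>0. \<forall>a b. a \<le> s \<and> s \<le> b \<and> b - a < e \<longrightarrow>
        has_lifts X f h (({0..1} \<inter> {a..b}) \<times> {c..d}))" for c d
    have "P 0 (1::real)"
    proof (rule Bolzano)
      fix c d e assume cd: "P c d" "P d e" "c \<le> d" "d \<le> e"
      show "P c e"
        unfolding P_def
      proof
        assume ce: "0 \<le> c \<and> e \<le> 1"
        obtain e1 where e1: "e1 > 0" "\<forall>a b. a \<le> s \<and> s \<le> b \<and> b - a < e1 \<longrightarrow>
            has_lifts X f h (({0..1} \<inter> {a..b}) \<times> {c..d})"
          using cd ce unfolding P_def by force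
        obtain e2 where e2: "e2 > 0" "\<forall>a b. a \<le> s \<and> s \<le> b \<and> b - a < e2 \<longrightarrow>
            has_lifts X f h (({0..1} \<inter> {a..b}) \<times> {d..e})"
          using cd ce unfolding P_def by force
        have "has_lifts X f h (({0..1} \<inter> {a..b}) \<times> {c..e})"
          if ab: "a \<le> s \<and> s \<le> b \<and> b - a < min e1 e2" for a b
        proof -
          let ?I = "{0..1} \<inter> {a..b}"
          have un: "?I \<times> {c..e} = ?I \<times> {c..d} \<union> ?I \<times> {d..e}"
            using cd(3,4) by auto
          have int: "?I \<times> {c..d} \<inter> ?I \<times> {d..e} = ?I \<times> {d}"
            using cd(3,4) by auto
          show ?thesis
            unfolding un
          proof (rule has_lifts_Un; (unfold int)?)
            show "connected (?I \<times> {d})"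
              by (intro convex_connected convex_Times convex_Int) auto
            show "?I \<times> {d} \<noteq> {}" using s ab by auto
          qed (use e1 e2 ab in \<open>auto intro!: closed_Times\<close>)
        qed
        then show "\<exists>e0>0. \<forall>a b. a \<le> s \<and> s \<le> b \<and> b - a < e0 \<longrightarrow>
            has_lifts X f h (({0..1} \<inter> {a..b}) \<times> {c..e})"
          using e1(1) e2(1) by (intro exI[of _ "min e1 e2"]) auto
      qed
    next
      fix t :: real assume "0 \<le> t" "t \<le> 1"
      then obtain e where e: "e > 0" "\<And>K. K \<subseteq> ?Q \<inter> ({s-e..s+e} \<times> {t-e..t+e}) \<Longrightarrow> has_lifts X f h K"
        using nbhd[OF s, of t] by auto
      have "P c d" if "c \<le> t \<and> t \<le> d \<and> d - c < e" for c d
        unfolding P_def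
        using that by (intro impI exI[of _ e] conjI allI e) auto
      then show "\<exists>d>0. \<forall>a b. a \<le> t \<and> t \<le> b \<and> b - a < d \<longrightarrow> P a b"
        using e(1) by blast
    qed auto
    then show ?thesis unfolding P_def by auto
  qed
  define P where "P a b \<longleftrightarrow> 0 \<le> a \<and> b \<le> 1 \<longrightarrow> has_lifts X f h ({a..b} \<times> {0..1})" for a b :: real
  have "P 0 1"
  proof (rule Bolzano)
    fix a b c assume P: "P a b" "P b c" "a \<le> b" "b \<le> c"
    show "P a c"
      unfolding P_def
    proof
      assume ac: "0 \<le> a \<and> c \<le> 1"
      have un: "{a..c} \<times> {0..1::real} = {a..b} \<times> {0..1} \<union> {b..c} \<times> {0..1}"
        and int: "{a..b} \<times> {0..1::real} \<inter> {b..c} \<times> {0..1} = {b} \<times> {0..1}"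
        using P(3,4) by auto
      show "has_lifts X f h ({a..c} \<times> {0..1})"
        unfolding un
      proof (rule has_lifts_Un; (unfold int)?)
        show "connected ({b} \<times> {0..1::real})"
          by (intro convex_connected convex_Times) auto
      qed (use P ac in \<open>auto simp: P_def intro!: closed_Times\<close>)
    qed
  next
    fix s :: real assume "0 \<le> s" "s \<le> 1"
    then obtain e where e: "e > 0" and *: "\<And>a b. a \<le> s \<and> s \<le> b \<and> b - a < e \<Longrightarrow>
        has_lifts X f h (({0..1} \<inter> {a..b}) \<times> {0..1})"
      using strip[of s] by auto
    have "P a b" if "a \<le> s \<and> s \<le> b \<and> b - a < e" for a b
    proof (unfold P_def, intro impI)
      assume "0 \<le> a \<and> b \<le> 1"
      then have eq: "{0..1} \<inter> {a..b} = {a..b}" by auto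
      show "has_lifts X f h ({a..b} \<times> {0..1})" using *[OF that] unfolding eq .
    qed
    then show "\<exists>d>0. \<forall>a b. a \<le> s \<and> s \<le> b \<and> b - a < d \<longrightarrow> P a b"
      using e by blast
  qed auto
  then show ?thesis unfolding P_def by auto
qed

text \<open>A path is a map on the square that depends only on the second coordinate.\<close>

lemma path_lift:
  assumes p: "path p" "path_image p \<subseteq> Y" and x: "x \<in> X" "f x = pathstart p"
  obtains q where "path q" "path_image q \<subseteq> X" "pathstart q = x"
    "\<And>t. t \<in> {0..1} \<Longrightarrow> f (q t) = p t"
proof -
  let ?Q = "{0..1::real} \<times> {0..1::real}"
  have "continuous_on ?Q (\<lambda>z. p (snd z))"
    by (rule continuous_on_compose2[OF p(1)[unfolded path_def]]) (auto intro: continuous_intros)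
  then have "has_lifts X f (\<lambda>z. p (snd z)) ?Q"
    using p(2) by (intro has_lifts_square) (auto simp: path_image_def)
  moreover have "(0,0) \<in> ?Q" "f x = p (snd (0::real, 0))" using x by (auto simp: pathstart_def)
  ultimately obtain g where g: "continuous_on ?Q g" "g ` ?Q \<subseteq> X"
      "\<forall>z\<in>?Q. f (g z) = p (snd z)" "g (0,0) = x"
    using x(1) unfolding has_lifts_def by meson
  show ?thesis
  proof
    show "path (\<lambda>t. g (0, t))"
      unfolding path_def by (rule continuous_on_compose2[OF g(1)]) (auto intro!: continuous_intros)
  qed (use g in \<open>auto simp: path_image_def pathstart_def\<close>)
qed

text \<open>Lift the homotopy from the common initial point. By uniqueness its four edges are \<open>p'\<close>, \<open>q'\<close> and
  two lifts of constant paths, which are constant.\<close>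

lemma homotopy_lift:
  assumes pq: "homotopic_paths Y p q"
    and p': "path p'" "path_image p' \<subseteq> X" "\<And>t. t \<in> {0..1} \<Longrightarrow> f (p' t) = p t"
    and q': "path q'" "path_image q' \<subseteq> X" "\<And>t. t \<in> {0..1} \<Longrightarrow> f (q' t) = q t"
    and start: "pathstart p' = pathstart q'"
  shows "homotopic_paths X p' q'"
proof -
  let ?I = "{0..1::real}"
  obtain h where h: "continuous_on (?I \<times> ?I) h" "h ` (?I \<times> ?I) \<subseteq> Y"
      "\<And>t. t \<in> ?I \<Longrightarrow> h (0,t) = p t" "\<And>t. t \<in> ?I \<Longrightarrow> h (1,t) = q t"
      "\<And>s. s \<in> ?I \<Longrightarrow> h (s,0) = p 0" "\<And>s. s \<in> ?I \<Longrightarrow> h (s,1) = p 1"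
    using pq unfolding homotopic_paths image_subset_iff_funcset[symmetric]
    by (auto simp: pathstart_def pathfinish_def)
  have "has_lifts X f h (?I \<times> ?I)"
    using h by (intro has_lifts_square) auto
  moreover have "(0,0) \<in> ?I \<times> ?I" "p' 0 \<in> X" "f (p' 0) = h (0, 0)"
    using p' h(3)[of 0] by (auto simp: path_image_def)
  ultimately obtain g where g: "continuous_on (?I \<times> ?I) g" "g ` (?I \<times> ?I) \<subseteq> X"
      "\<forall>z\<in>?I \<times> ?I. f (g z) = h z" "g (0,0) = p' 0"
    unfolding has_lifts_def by meson
  have gs: "continuous_on ?I (\<lambda>t. g (s, t))" "continuous_on ?I (\<lambda>t. g (t, s))" if "s \<in> ?I" for s
    using that by (auto intro!: continuous_on_compose2[OF g(1)] continuous_intros)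
  have I: "connected ?I" by simp
  have g_0: "g (s, 0) = p' 0" if "s \<in> ?I" for s
    by (rule lift_unique[OF I gs(2)[of 0] _ continuous_on_const[of _ "p' 0"], where k=0])
      (use that g h p' in \<open>auto simp: path_image_def\<close>)
  have g_1: "g (s, 1) = g (0, 1)" if "s \<in> ?I" for s
    by (rule lift_unique[OF I gs(2)[of 1] _ continuous_on_const[of _ "g (0, 1)"], where k=0])
      (use that g h p' in \<open>auto simp: path_image_def\<close>)
  have g0: "g (0, t) = p' t" if "t \<in> ?I" for t
    by (rule lift_unique[OF I gs(1)[of 0] _ p'(1)[unfolded path_def], where k=0])
      (use that g h p' in \<open>auto simp: path_image_def\<close>)
  have g1: "g (1, t) = q' t" if "t \<in> ?I" for t
    by (rule lift_unique[OF I gs(1)[of 1] _ q'(1)[unfolded path_def], where k=0])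
      (use that g h q' g_0[of 1] start in \<open>auto simp: path_image_def pathstart_def\<close>)
  show ?thesis
    unfolding homotopic_paths image_subset_iff_funcset[symmetric]
    using g g_0 g_1 g0 g1
    by (intro exI[of _ g]) (auto simp: pathstart_def pathfinish_def)
qed

end

section \<open>Finite coverings and subgroups of the fundamental group\<close>

text \<open>The fibre over \<open>y\<close> is compact, hence covered by a finite family \<open>\<F>\<close> of open sets on which \<open>f\<close> is
  injective. Over the points of \<open>\<Inter>T\<in>\<F>. f ` T\<close> that are not images of points outside \<open>\<Union>\<F>\<close>, the inverses of
  the restrictions of \<open>f\<close> to the members of \<open>\<F>\<close> are sections through all points of the preimage.
  This set is open because \<open>f\<close> is both open and closed.\<close>

lemma compact_local_homeomorphism_covering:
  fixes X :: "'a::topological_space set" and Y :: "'b::topological_space set"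
  assumes hX: "Hausdorff_space (top_of_set X)" and hY: "Hausdorff_space (top_of_set Y)"
    and X: "compact X" and f: "continuous_on X f" "f ` X \<subseteq> Y"
    and inj: "\<And>x. x \<in> X \<Longrightarrow> \<exists>T. openin (top_of_set X) T \<and> x \<in> T \<and> inj_on f T"
    and op: "\<And>T. openin (top_of_set X) T \<Longrightarrow> openin (top_of_set Y) (f ` T)"
  shows "covering_projection X Y f"
    and "y \<in> Y \<Longrightarrow> finite (X \<inter> f -` {y})"
proof -
  have cX: "compact_space (top_of_set X)"
    using X by (simp add: compact_space_subtopology)
  have cm: "continuous_map (top_of_set X) (top_of_set Y) f"
    using f by auto
  have fibre: "\<exists>\<F>. finite \<F> \<and> (\<forall>T\<in>\<F>. openin (top_of_set X) T \<and> inj_on f T \<and> y \<in> f ` T) \<and> X \<inter> f -` {y} \<subseteq> \<Union>\<F>"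
    if y: "y \<in> Y" for y
  proof -
    have "closedin (top_of_set Y) {y}"
      using y closedin_Hausdorff_singleton[OF hY, of y] by simp
    then have "closedin (top_of_set X) (X \<inter> f -` {y})"
      by (rule continuous_closedin_preimage_gen[OF f(1) f(2)[unfolded image_subset_iff_funcset]])
    then have "compactin (top_of_set X) (X \<inter> f -` {y})"
      by (rule closedin_compact_space[OF cX])
    moreover have "X \<inter> f -` {y} \<subseteq> \<Union>{T. openin (top_of_set X) T \<and> inj_on f T \<and> y \<in> f ` T}"
      using inj by fastforce
    ultimately obtain \<F> where "finite \<F>" "\<F> \<subseteq> {T. openin (top_of_set X) T \<and> inj_on f T \<and> y \<in> f ` T}"
        "X \<inter> f -` {y} \<subseteq> \<Union>\<F>"
      unfolding compactin_def by (metis (no_types, lifting) mem_Collect_eq)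
    then show ?thesis by blast
  qed
  show "finite (X \<inter> f -` {y})" if y: "y \<in> Y"
  proof -
    obtain \<F> where \<F>: "finite \<F>" "\<forall>T\<in>\<F>. openin (top_of_set X) T \<and> inj_on f T \<and> y \<in> f ` T"
        "X \<inter> f -` {y} \<subseteq> \<Union>\<F>"
      using fibre[OF y] by blast
    have "finite (T \<inter> f -` {y})" if "T \<in> \<F>" for T
    proof (rule finite_imageD[of f])
      show "finite (f ` (T \<inter> f -` {y}))" by (rule finite_subset[of _ "{y}"]) auto
      show "inj_on f (T \<inter> f -` {y})" using \<F>(2) that by (meson inf_le1 inj_on_subset)
    qed
    then have "finite (\<Union>T\<in>\<F>. T \<inter> f -` {y})" using \<F>(1) by blast
    then show ?thesis by (rule finite_subset[rotated]) (use \<F>(3) in blast)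
  qed
  show "covering_projection X Y f"
  proof
    fix y assume y: "y \<in> Y"
    obtain \<F> where \<F>: "finite \<F>" "\<forall>T\<in>\<F>. openin (top_of_set X) T \<and> inj_on f T \<and> y \<in> f ` T"
        "X \<inter> f -` {y} \<subseteq> \<Union>\<F>"
      using fibre[OF y] by blast
    have TX: "T \<subseteq> X" if "T \<in> \<F>" for T using \<F>(2) that openin_imp_subset by blast
    let ?V = "(Y \<inter> (\<Inter>T\<in>\<F>. f ` T)) - f ` (X - \<Union>\<F>)"
    have V: "openin (top_of_set Y) ?V"
    proof (rule openin_diff)
      show "openin (top_of_set Y) (Y \<inter> (\<Inter>T\<in>\<F>. f ` T))"
      (* If the fibre is empty, so is the family, and the intersection is everything. *)
      proof (cases "\<F> = {}")
        case False
        then show ?thesis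
          using \<F> op by (intro openin_Int openin_INT2) auto
      qed auto
      have "openin (top_of_set X) (\<Union>\<F>)" using \<F>(2) by blast
      then have "closedin (top_of_set X) (X - \<Union>\<F>)"
        by (metis closedin_diff closedin_topspace topspace_euclidean_subtopology)
      then show "closedin (top_of_set Y) (f ` (X - \<Union>\<F>))"
        using T1_Spaces.continuous_imp_closed_map[OF cm cX hY] by (simp add: closed_map_def)
    qed
    have yV: "y \<in> ?V" using y \<F> by auto
    have "\<exists>s. continuous_on ?V s \<and> s ` ?V \<subseteq> X \<and> (\<forall>z\<in>?V. f (s z) = z) \<and> s (f x) = x"
      if x: "x \<in> X" "f x \<in> ?V" for x
    proof -
      obtain T where T: "T \<in> \<F>" "x \<in> T" using x by blast
      have injT: "inj_on f T" and oT: "openin (top_of_set X) T" using \<F>(2) T by auto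
      have "continuous_on (f ` T) (inv_into T f)"
      proof (rule continuous_on_inverse_open_map[OF _ refl])
        show "continuous_on T f" using f(1) TX[OF T(1)] continuous_on_subset by blast
        show "inv_into T f (f x) = x" if "x \<in> T" for x using injT that by simp
        fix U assume "openin (top_of_set T) U"
        then have U: "openin (top_of_set X) U" "U \<subseteq> T"
          using oT openin_trans openin_imp_subset by blast+
        have "f ` U \<subseteq> f ` T" "f ` T \<subseteq> Y" using U(2) TX[OF T(1)] f(2) by auto
        then show "openin (top_of_set (f ` T)) (f ` U)"
          using op[OF U(1)] openin_subset_trans by blast
      qed
      moreover have VT: "?V \<subseteq> f ` T" using T(1) by blast
      ultimately have "continuous_on ?V (inv_into T f)" using continuous_on_subset by blast
      moreover have "inv_into T f ` ?V \<subseteq> X"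
        using VT TX[OF T(1)] by (meson image_subsetI inv_into_into subsetD)
      moreover have "\<forall>z\<in>?V. f (inv_into T f z) = z"
        using VT by (meson f_inv_into_f subsetD)
      moreover have "inv_into T f (f x) = x" using injT T(2) by simp
      ultimately show ?thesis by blast
    qed
    then show "\<exists>V. openin (top_of_set Y) V \<and> y \<in> V \<and> (\<forall>x\<in>X. f x \<in> V \<longrightarrow>
            (\<exists>s. continuous_on V s \<and> s ` V \<subseteq> X \<and> (\<forall>z\<in>V. f (s z) = z) \<and> s (f x) = x))"
      using V yV by meson
  qed (use hX f inj in auto)
qed

context covering_projection
begin

lemma path_in_image: "path_in X p a b \<Longrightarrow> path_in Y (f \<circ> p) (f a) (f b)"
  unfolding path_in_def pathstart_compose pathfinish_compose path_image_compose
  using path_continuous_image[of p f] continuous_on_subset[OF continuous] maps_into by blast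

lemma homotopic_paths_image: "homotopic_paths X p q \<Longrightarrow> homotopic_paths Y (f \<circ> p) (f \<circ> q)"
  using continuous maps_into by (auto intro: homotopic_paths_continuous_image)

lemma path_in_lift:
  assumes p: "path_in Y p (f x) b" and x: "x \<in> X"
  obtains q where "path_in X q x (pathfinish q)" "path_class Y (f \<circ> q) = path_class Y p"
    "f (pathfinish q) = b"
proof -
  obtain q where q: "path q" "path_image q \<subseteq> X" "pathstart q = x" "\<And>t. t \<in> {0..1} \<Longrightarrow> f (q t) = p t"
    using path_lift[of p x] p x by (auto simp: path_in_def)
  have "homotopic_paths Y p (f \<circ> q)"
    by (rule homotopic_paths_eq) (use p q in \<open>auto simp: path_in_def\<close>)
  then have "path_class Y (f \<circ> q) = path_class Y p"
    using path_class_eq[OF p, of "f \<circ> q"] by metis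
  moreover have "f (pathfinish q) = b"
    using p q(4)[of 1] by (auto simp: path_in_def pathfinish_def)
  ultimately show ?thesis using that q by (auto simp: path_in_def)
qed

text \<open>Injectivity of the induced homomorphism: a homotopy downstairs between images of paths with the
  same initial point lifts.\<close>

lemma path_class_image_inj:
  assumes p: "path_in X p a b" and q: "path_in X q a c"
    and eq: "path_class Y (f \<circ> p) = path_class Y (f \<circ> q)"
  shows "path_class X p = path_class X q"
proof -
  have "homotopic_paths Y (f \<circ> p) (f \<circ> q)"
    using eq path_class_eq[OF path_in_image[OF p]] by simp
  then have "homotopic_paths X p q"
    by (rule homotopy_lift) (use p q in \<open>auto simp: path_in_def\<close>)
  then show ?thesis
    using path_class_eq[OF p] by simp
qed

text \<open>The image of the fundamental group of \<open>X\<close> at \<open>x\<close> under the homomorphism induced by \<open>f\<close>.\<close>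

definition image_group :: "'a \<Rightarrow> (real \<Rightarrow> 'b) set set" where
  "image_group x = {path_class Y (f \<circ> p) |p. path_in X p x x}"

lemma image_group:
  assumes x: "x \<in> X"
  defines "G \<equiv> fundamental_group Y (f x)"
  shows subgroup_image_group: "subgroup (image_group x) G"
    and image_group_iso: "G\<lparr>carrier := image_group x\<rparr> \<cong> fundamental_group X x"
proof -
  let ?F = "induced Y (\<lambda>p. f \<circ> p)"
  let ?K = "fundamental_group X x"
  have fx: "f x \<in> Y" using x maps_into by blast
  have ind: "?F (path_class X p) = path_class Y (f \<circ> p)" if "path_in X p x x" for p
    using homotopic_paths_image by (rule induced_path_class[OF that])
  have hom: "?F \<in> hom ?K G"
    unfolding G_def
    by (rule induced_hom) (auto simp: path_compose_join intro: path_in_image homotopic_paths_image)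
  interpret K: group ?K using group_fundamental_group[OF x] .
  interpret G: group G unfolding G_def using group_fundamental_group[OF fx] .
  interpret F: group_hom ?K G ?F
    using hom by unfold_locales
  have img: "?F ` carrier ?K = image_group x"
    by (auto simp: carrier_fundamental_group loops_at_eq_path_in image_group_def ind image_image
        cong: image_cong_simp) 
  then show "subgroup (image_group x) G"
    using F.img_is_subgroup by simp
  have "inj_on ?F (carrier ?K)"
  proof (rule inj_onI)
    fix P Q assume PQ: "P \<in> carrier ?K" "Q \<in> carrier ?K" "?F P = ?F Q"
    then obtain p q where p: "path_in X p x x" "P = path_class X p"
      and q: "path_in X q x x" "Q = path_class X q"
      by (auto simp: carrier_fundamental_group loops_at_eq_path_in)
    then have "path_class Y (f \<circ> p) = path_class Y (f \<circ> q)"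
      using PQ(3) ind by simp
    then show "P = Q"
      using path_class_image_inj[OF p(1) q(1)] p(2) q(2) by simp
  qed
  then have "?F \<in> iso ?K (G\<lparr>carrier := image_group x\<rparr>)"
    using hom img by (auto simp: iso_def hom_def bij_betw_def)
  then show "G\<lparr>carrier := image_group x\<rparr> \<cong> ?K"
    using K.iso_sym by (auto simp: is_iso_def)
qed

text \<open>The coset of a loop \<open>l\<close> is determined by the end point \<open>z\<close> of its lift \<open>q\<close> starting at \<open>x\<close>: with
  a fixed path \<open>\<sigma> z\<close> from \<open>x\<close> to \<open>z\<close>, the loop \<open>l\<close> differs from the image of \<open>\<sigma> z\<close> by the image of a
  closed loop at \<open>x\<close>. So there are no more cosets than points in the fibre.\<close>

lemma finite_rcosets_image_group:
  assumes x: "x \<in> X" and pc: "path_connected X" and fin: "finite (X \<inter> f -` {f x})"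
  shows "finite (rcosets\<^bsub>fundamental_group Y (f x)\<^esub> (image_group x))"
proof -
  let ?G = "fundamental_group Y (f x)"
  have fx: "f x \<in> Y" using x maps_into by blast
  interpret G: group ?G using group_fundamental_group[OF fx] .
  note sub = subgroup_image_group[OF x]
  have "\<exists>\<sigma>. path_in X \<sigma> x z" if "z \<in> X" for z
    using pc x that unfolding path_connected_def path_in_def by blast
  then obtain \<sigma> where \<sigma>: "\<And>z. z \<in> X \<Longrightarrow> path_in X (\<sigma> z) x z" by metis
  have "rcosets\<^bsub>?G\<^esub> (image_group x) \<subseteq>
      (\<lambda>z. image_group x #>\<^bsub>?G\<^esub> path_class Y (f \<circ> \<sigma> z)) ` (X \<inter> f -` {f x})"
  proof
    fix C assume "C \<in> rcosets\<^bsub>?G\<^esub> (image_group x)"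
    then obtain l where l: "path_in Y l (f x) (f x)" and C: "C = image_group x #>\<^bsub>?G\<^esub> path_class Y l"
      by (auto simp: RCOSETS_def carrier_fundamental_group loops_at_eq_path_in)
    obtain q where q: "path_in X q x (pathfinish q)" "path_class Y (f \<circ> q) = path_class Y l"
      "f (pathfinish q) = f x"
      using path_in_lift[OF l x] .
    let ?z = "pathfinish q"
    have z: "?z \<in> X" using q(1) by (metis path_in_def pathfinish_in_path_image subsetD)
    let ?m = "q +++ reversepath (\<sigma> ?z)"
    note s = \<sigma>[OF z] and rs = path_in_reverse[OF \<sigma>[OF z]]
    have m: "path_in X ?m x x" using path_in_join[OF q(1) rs] .
    have s': "path_in Y (f \<circ> \<sigma> ?z) (f x) (f x)" using path_in_image[OF s] q(3) by simp
    have "path_class X (?m +++ \<sigma> ?z) = path_class X q"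
    proof -
      have "path_class X (?m +++ \<sigma> ?z) = path_class X (q +++ (reversepath (\<sigma> ?z) +++ \<sigma> ?z))"
        by (rule path_class_assoc[OF q(1) rs s])
      also have "\<dots> = path_class X (q +++ (\<lambda>_. ?z))"
        by (rule path_class_join_cong[OF refl _ q(1) path_in_join[OF rs s]])
          (use homotopic_paths_reversepath_left[of "\<sigma> ?z" X] s in
            \<open>auto simp: path_class_eq[OF path_in_join[OF rs s]] path_in_def\<close>)
      also have "\<dots> = path_class X q"
        unfolding path_class_eq[OF path_in_join[OF q(1) path_in_const[OF z]]]
        using homotopic_paths_const_right[of q X] q(1) by (auto simp: path_in_def)
      finally show ?thesis .
    qed
    then have "homotopic_paths X (?m +++ \<sigma> ?z) q"
      using path_class_eq[OF path_in_join[OF m s]] by simp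
    then have "homotopic_paths Y (f \<circ> (?m +++ \<sigma> ?z)) (f \<circ> q)"
      by (rule homotopic_paths_image)
    then have "path_class Y (f \<circ> (?m +++ \<sigma> ?z)) = path_class Y l"
      using path_class_eq[OF path_in_image[OF path_in_join[OF m s]]] q(2) by blast
    then have "path_class Y l = path_class Y (f \<circ> ?m) \<otimes>\<^bsub>?G\<^esub> path_class Y (f \<circ> \<sigma> ?z)"
      using class_mult_in[OF path_in_image[OF m] s'] by (simp add: path_compose_join)
    then have "path_class Y l \<in> image_group x #>\<^bsub>?G\<^esub> path_class Y (f \<circ> \<sigma> ?z)"
      using m by (auto simp: r_coset_def image_group_def)
    moreover have "path_class Y (f \<circ> \<sigma> ?z) \<in> carrier ?G"
      using s' by (auto simp: carrier_fundamental_group loops_at_eq_path_in)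
    ultimately have "C = image_group x #>\<^bsub>?G\<^esub> path_class Y (f \<circ> \<sigma> ?z)"
      using G.repr_independence[OF _ _ sub] C by simp
    then show "C \<in> (\<lambda>z. image_group x #>\<^bsub>?G\<^esub> path_class Y (f \<circ> \<sigma> z)) ` (X \<inter> f -` {f x})"
      using z q(3) by auto
  qed
  then show ?thesis
    using fin finite_subset by blast
qed

text \<open>A path from \<open>x\<close> to \<open>z\<close> projects to a loop, which by assumption is homotopic to the image of a loop
  at \<open>x\<close>. Lifts of homotopic loops have the same end point.\<close>

lemma fibre_trivial:
  assumes x: "x \<in> X" and pc: "path_connected X"
    and full: "image_group x = carrier (fundamental_group Y (f x))"
    and z: "z \<in> X" "f z = f x"
  shows "z = x"
proof -
  obtain \<sigma> where \<sigma>: "path_in X \<sigma> x z"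
    using pc x z unfolding path_connected_def path_in_def by blast
  have "path_class Y (f \<circ> \<sigma>) \<in> image_group x"
    using path_in_image[OF \<sigma>] z(2) full by (auto simp: carrier_fundamental_group loops_at_eq_path_in)
  then obtain m where m: "path_in X m x x" "path_class Y (f \<circ> \<sigma>) = path_class Y (f \<circ> m)"
    by (auto simp: image_group_def)
  then have "path_class X \<sigma> = path_class X m"
    using path_class_image_inj[OF \<sigma>] by blast
  then have "homotopic_paths X \<sigma> m"
    using path_class_eq[OF \<sigma>] by simp
  then show "z = x"
    using \<sigma> m(1) by (auto simp: path_in_def dest: homotopic_paths_imp_pathfinish)
qed

text \<open>Two points in a fibre give two lifts of one path ending at \<open>f x\<close>. Both end at the only point above
  \<open>f x\<close>, so they agree there, and hence everywhere.\<close>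

lemma injective_if_fibre_trivial:
  assumes x: "x \<in> X" and pc: "path_connected X"
    and triv: "\<And>z. z \<in> X \<Longrightarrow> f z = f x \<Longrightarrow> z = x"
  shows "inj_on f X"
proof (rule inj_onI)
  fix a b assume ab: "a \<in> X" "b \<in> X" "f a = f b"
  obtain \<delta> where \<delta>: "path_in X \<delta> a x"
    using pc x ab unfolding path_connected_def path_in_def by blast
  have f\<delta>: "path_in Y (f \<circ> \<delta>) (f b) (f x)" using path_in_image[OF \<delta>] ab(3) by simp
  obtain \<beta> where \<beta>: "path \<beta>" "path_image \<beta> \<subseteq> X" "pathstart \<beta> = b"
      "\<And>t. t \<in> {0..1} \<Longrightarrow> f (\<beta> t) = (f \<circ> \<delta>) t"
    using path_lift[of "f \<circ> \<delta>" b] f\<delta> ab by (auto simp: path_in_def)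
  have "\<beta> 1 \<in> X" "f (\<beta> 1) = f x"
    using \<beta> \<delta> by (auto simp: path_image_def path_in_def pathfinish_def)
  then have "\<beta> 1 = x" by (rule triv)
  moreover have "\<delta> 1 = x" "\<delta> 0 = a" "\<beta> 0 = b"
    using \<delta> \<beta> by (auto simp: path_in_def pathfinish_def pathstart_def)
  moreover have "\<beta> 0 = \<delta> 0"
    by (rule lift_unique[of "{0..1}" _ _ 1])
      (use \<beta> \<delta> calculation in \<open>auto simp: path_in_def path_def path_image_def\<close>)
  ultimately show "a = b" by simp
qed

text \<open>The image of the fundamental group of \<open>X\<close> is a subgroup of finite index isomorphic to that group,
  so by hypothesis it is the whole group, which means that the covering has one sheet.\<close>

lemma injective_if_no_subgroup:
  assumes pc: "path_connected X" and y: "y \<in> f ` X" and x0: "x0 \<in> X" and fin: "finite (X \<inter> f -` {y})"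
    and no: "\<not> (\<exists>H. subgroup H (fundamental_group Y y) \<and> H \<noteq> carrier (fundamental_group Y y) \<and>
               finite (rcosets\<^bsub>fundamental_group Y y\<^esub> H) \<and>
               (fundamental_group Y y)\<lparr>carrier := H\<rparr> \<cong> fundamental_group X x0)"
  shows "inj_on f X"
proof -
  obtain x where x: "x \<in> X" "y = f x" using y by blast
  obtain \<alpha> where \<alpha>: "path_in X \<alpha> x0 x"
    using pc x x0 unfolding path_connected_def path_in_def by blast
  have "(fundamental_group Y y)\<lparr>carrier := image_group x\<rparr> \<cong> fundamental_group X x0"
    using image_group_iso[OF x(1)] fundamental_group_basepoint_iso[OF \<alpha>] iso_trans x(2) by metis
  then have "image_group x = carrier (fundamental_group Y y)"
    using no subgroup_image_group[OF x(1)] finite_rcosets_image_group[OF x(1) pc] fin x(2) by blast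
  then show ?thesis
    using fibre_trivial[OF x(1) pc] injective_if_fibre_trivial[OF x(1) pc] x(2) by blast
qed

end

section \<open>Charts, boundaries and model domains\<close>

lemma half_space_inner: "(half_space :: (real ^ 'n::{finite,linorder}) set) = {x. axis (Min UNIV) 1 \<bullet> x \<ge> 0}"
  by (auto simp: half_space_def inner_axis inner_commute)

text \<open>The common features of the two admissible model domains; all later arguments use only these and
  treat the whole space and the half-space alike. The last one provides the directions along which
  derivatives within the model domain are unique.\<close>

lemma chart_image:
  fixes \<phi> :: "'a::topological_space \<Rightarrow> real ^ 'n::{finite,linorder}"
  assumes "is_chart X (U, \<phi>)"
  shows chart_openin: "openin (top_of_set X) U"
    and chart_homeomorphism: "homeomorphism U (\<phi> ` U) \<phi> (inv_into U \<phi>)"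
    and chart_image_convex: "convex (\<phi> ` U)"
    and chart_image_closed: "closed (\<phi> ` U)"
    and chart_image_interior: "interior (\<phi> ` U) \<noteq> {}"
    and chart_image_translate: "\<And>z b t. z \<in> \<phi> ` U \<Longrightarrow> b \<in> Basis \<Longrightarrow> 0 \<le> t \<Longrightarrow> z + t *\<^sub>R b \<in> \<phi> ` U"
proof -
  show "openin (top_of_set X) U" using assms by (simp add: is_chart_def)
  obtain \<psi> where \<psi>: "homeomorphism U UNIV \<phi> \<psi> \<or> homeomorphism U half_space \<phi> \<psi>"
    using assms by (auto simp: is_chart_def)
  then have D: "\<phi> ` U = UNIV \<or> \<phi> ` U = half_space" and h: "homeomorphism U (\<phi> ` U) \<phi> \<psi>"
    by (auto simp: homeomorphism_def)
  have inj: "inj_on \<phi> U"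
    using h by (metis homeomorphism_def inj_on_inverseI)
  have "inv_into U \<phi> y = \<psi> y" if "y \<in> \<phi> ` U" for y
    using h inj that by (auto simp: homeomorphism_def)
  then show "homeomorphism U (\<phi> ` U) \<phi> (inv_into U \<phi>)"
    by (intro homeomorphism_cong[OF h refl refl]) auto
  have ax: "axis (Min UNIV) (1::real) \<noteq> (0 :: real ^ 'n::{finite,linorder})"
    by (simp add: axis_eq_0_iff)
  show "convex (\<phi> ` U)"
    using D by (auto simp: half_space_inner convex_halfspace_ge)
  show "closed (\<phi> ` U)"
    using D by (auto simp: half_space_inner closed_halfspace_ge)
  have "axis (Min UNIV) 1 \<in> {x :: real ^ 'n::{finite,linorder}. axis (Min UNIV) 1 \<bullet> x > 0}"
    by (simp add: inner_axis)
  then have "interior (half_space :: (real ^ 'n::{finite,linorder}) set) \<noteq> {}"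
    unfolding half_space_inner interior_halfspace_ge[OF ax] by blast
  then show "interior (\<phi> ` U) \<noteq> {}"
    using D by auto
  fix z b :: "real ^ 'n::{finite,linorder}" and t :: real
  assume z: "z \<in> \<phi> ` U" and "b \<in> Basis" and t: "0 \<le> t"
  then have "0 \<le> b $ Min UNIV"
    by (auto simp: Basis_vec_def axis_def)
  then have "0 \<le> t * b $ Min UNIV"
    using t by simp
  then have half: "z \<in> half_space \<Longrightarrow> z + t *\<^sub>R b \<in> half_space"
    by (simp add: half_space_def)
  from D show "z + t *\<^sub>R b \<in> \<phi> ` U"
  proof
    assume "\<phi> ` U = half_space"
    with half z show ?thesis by (simp only:)
  qed simp
qed

text \<open>An injective continuous map defined on a full neighbourhood \<open>W\<close> is open, by invariance of domain,
  so near \<open>g p\<close> the only question is whether points of \<open>E\<close> can come from \<open>W - D\<close>. In a small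
  ball \<open>B\<close>, points of \<open>interior E\<close> do not come from \<open>frontier D\<close>, so the connected set
  \<open>B \<inter> interior E\<close> is the disjoint union of the open parts that come from \<open>interior D\<close> and from
  \<open>W - D\<close>. The first part is nonempty, so the second is empty, and density of \<open>interior E\<close> in \<open>E\<close>
  extends this to boundary points.\<close>

lemma neighbourhood_in_convex_image:
  fixes g :: "'a::euclidean_space \<Rightarrow> 'a"
  assumes W: "open W" and g: "continuous_on W g" "inj_on g W"
    and D: "closed D" "convex D" "interior D \<noteq> {}"
    and E: "convex E" "interior E \<noteq> {}"
    and into: "g ` (W \<inter> D) \<subseteq> E" and bdry: "g ` (W \<inter> frontier D) \<subseteq> frontier E"
    and p: "p \<in> W" "p \<in> D"
  obtains N where "open N" "g p \<in> N" "N \<inter> E \<subseteq> g ` (W \<inter> D)"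
proof -
  have op: "open (g ` T)" if "open T" "T \<subseteq> W" for T
    using that g invariance_of_domain by (metis continuous_on_subset inj_on_subset)
  have "open (g ` W)" "g p \<in> g ` W"
    using op[OF W] p by auto
  then obtain e where e: "e > 0" "ball (g p) e \<subseteq> g ` W"
    by (meson open_contains_ball)
  define B where "B = ball (g p) e"
  let ?C = "B \<inter> interior E" and ?A1 = "g ` (W \<inter> interior D)" and ?A2 = "g ` (W - D)"
  have A: "open ?A1" "open ?A2"
    by (rule op; use W D(1) in auto)+
  have "?A1 \<subseteq> E" using into interior_subset by blast
  then have A1E: "?A1 \<subseteq> interior E" using A(1) by (simp add: interior_maximal)
  have cover: "?C \<subseteq> ?A1 \<union> ?A2"
  proof
    fix y assume y: "y \<in> ?C"
    then obtain w where w: "w \<in> W" "y = g w" using e(2) by (auto simp: B_def)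
    have "w \<notin> frontier D"
      using y w bdry by (auto simp: frontier_def)
    then show "y \<in> ?A1 \<union> ?A2"
      using w D(1) by (auto simp: frontier_def)
  qed
  have disj: "?A1 \<inter> ?A2 = {}"
    using g(2) interior_subset[of D] by (auto simp: inj_on_def)
  have "open (W \<inter> g -` B)"
    using continuous_open_preimage[OF g(1) W] by (simp add: B_def)
  moreover have "p \<in> closure (interior D)"
    using convex_closure_interior[OF D(2,3)] p(2) closure_subset by blast
  moreover have "p \<in> W \<inter> g -` B"
    using p e by (simp add: B_def)
  ultimately have "(W \<inter> g -` B) \<inter> interior D \<noteq> {}"
    by (meson disjoint_iff open_Int_closure_eq_empty)
  then have "?A1 \<inter> ?C \<noteq> {}"
    using A1E by blast
  moreover have "connected ?C"
    unfolding B_def using E by (intro convex_connected convex_Int) auto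
  ultimately have A2C: "?A2 \<inter> ?C = {}"
    using connectedD[OF _ A, of ?C] cover disj by blast
  show ?thesis
  proof
    show "open B" "g p \<in> B" using e by (auto simp: B_def)
    show "B \<inter> E \<subseteq> g ` (W \<inter> D)"
    proof
      fix y assume y: "y \<in> B \<inter> E"
      then obtain w where w: "w \<in> W" "y = g w" using e(2) by (auto simp: B_def)
      have "w \<in> D"
      proof (rule ccontr)
        assume "w \<notin> D"
        then have "y \<in> ?A2 \<inter> B" using w y by blast
        moreover have "y \<in> closure (interior E)"
          using convex_closure_interior[OF E] y closure_subset by blast
        moreover have "open (?A2 \<inter> B)" using A by (auto simp: B_def)
        ultimately have "(?A2 \<inter> B) \<inter> interior E \<noteq> {}"
          by (meson disjoint_iff open_Int_closure_eq_empty)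
        then show False using A2C by blast
      qed
      then show "y \<in> g ` (W \<inter> D)" using w by blast
    qed
  qed
qed

text \<open>If a point on the frontier of the model domain had a Euclidean neighbourhood, the chart would
  embed it into the model domain, and by invariance of domain its image would be open.\<close>

lemma manifold_boundary_chart:
  fixes \<phi> :: "'a::topological_space \<Rightarrow> real ^ 'n::{finite,linorder}"
  assumes c: "is_chart X (U, \<phi>)" and x: "x \<in> U"
  shows "x \<in> manifold_boundary TYPE('n) X \<longleftrightarrow> \<phi> x \<in> frontier (\<phi> ` U)"
proof -
  note U = chart_openin[OF c] and hom = chart_homeomorphism[OF c]
  have frontier: "frontier (\<phi> ` U) = \<phi> ` U - interior (\<phi> ` U)"
    using chart_image_closed[OF c] by (simp add: frontier_def)
  have xX: "x \<in> X" using U x by (meson openin_imp_subset subsetD)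
  have "(\<exists>T. openin (top_of_set X) T \<and> x \<in> T \<and> T homeomorphic (UNIV :: (real ^ 'n::{finite,linorder}) set))
     \<longleftrightarrow> \<phi> x \<in> interior (\<phi> ` U)"
  proof
    assume "\<phi> x \<in> interior (\<phi> ` U)"
    then obtain e where e: "e > 0" "ball (\<phi> x) e \<subseteq> \<phi> ` U"
      by (meson mem_interior)
    let ?T = "U \<inter> \<phi> -` ball (\<phi> x) e"
    have "openin (top_of_set U) ?T"
      using hom by (intro continuous_openin_preimage_gen) (auto simp: homeomorphism_def)
    then have "openin (top_of_set X) ?T"
      using U openin_trans by blast
    moreover have "\<phi> ` ?T = ball (\<phi> x) e"
      using e(2) by auto
    then have "?T homeomorphic ball (\<phi> x) e"
      unfolding homeomorphic_def using homeomorphism_of_subsets[OF hom _ e(2), of ?T] by blast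
    then have "?T homeomorphic (UNIV :: (real ^ 'n::{finite,linorder}) set)"
      using homeomorphic_ball_UNIV[OF e(1)] homeomorphic_trans by blast
    ultimately show "\<exists>T. openin (top_of_set X) T \<and> x \<in> T \<and> T homeomorphic (UNIV :: (real ^ 'n::{finite,linorder}) set)"
      using x e by (intro exI[of _ ?T]) auto
  next
    assume "\<exists>T. openin (top_of_set X) T \<and> x \<in> T \<and> T homeomorphic (UNIV :: (real ^ 'n::{finite,linorder}) set)"
    then obtain T k k' where T: "openin (top_of_set X) T" "x \<in> T"
      and k: "homeomorphism T (UNIV :: (real ^ 'n::{finite,linorder}) set) k k'"
      by (auto simp: homeomorphic_def)
    have TU: "openin (top_of_set T) (T \<inter> U)"
      using T(1) U by (meson openin_Int openin_imp_subset openin_subset_trans inf_le1)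
    have "open (k ` (T \<inter> U))"
      using homeomorphism_imp_open_map[OF k TU] by simp
    moreover have k'k: "k' ` k ` (T \<inter> U) = T \<inter> U"
      by (simp add: image_image homeomorphism_apply1[OF k] cong: image_cong_simp)
    moreover have "continuous_on (k ` (T \<inter> U)) (\<phi> \<circ> k')"
    proof (rule continuous_on_compose)
      show "continuous_on (k ` (T \<inter> U)) k'"
        using homeomorphism_cont2[OF k] continuous_on_subset by blast
      show "continuous_on (k' ` k ` (T \<inter> U)) \<phi>"
        unfolding k'k using homeomorphism_cont1[OF hom] continuous_on_subset by blast
    qed
    moreover have "inj_on (\<phi> \<circ> k') (k ` (T \<inter> U))"
    proof (rule comp_inj_on)
      show "inj_on k' (k ` (T \<inter> U))"
        using k by (metis homeomorphism_def inj_on_inverseI inj_on_subset subset_UNIV)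
      show "inj_on \<phi> (k' ` k ` (T \<inter> U))"
        unfolding k'k using hom by (metis homeomorphism_def inf_le2 inj_on_inverseI inj_on_subset)
    qed
    ultimately have "open ((\<phi> \<circ> k') ` k ` (T \<inter> U))"
      using invariance_of_domain by blast
    then have "open (\<phi> ` (T \<inter> U))"
      by (simp only: image_comp[symmetric] k'k)
    then show "\<phi> x \<in> interior (\<phi> ` U)"
      using T(2) x by (intro interiorI[of "\<phi> ` (T \<inter> U)"]) auto
  qed
  then show ?thesis
    using x xX unfolding manifold_boundary_def frontier by blast
qed

section \<open>Local behaviour of maps with nondegenerate differential\<close>

text \<open>The Jacobian determinant is continuous, and a continuously differentiable map is injective near
  a point where its derivative is.\<close>

lemma regular_point_neighbourhood:
  fixes g :: "real ^ 'n \<Rightarrow> real ^ 'n"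
  assumes W: "open W" and g: "times_cont_diff_on 1 g W" and p: "p \<in> W"
    and nz: "det (matrix (frechet_derivative g (at p))) \<noteq> 0"
  obtains W' where "open W'" "p \<in> W'" "W' \<subseteq> W" "inj_on g W'"
    "\<And>x. x \<in> W' \<Longrightarrow> det (matrix (frechet_derivative g (at x))) \<noteq> 0"
proof -
  let ?D = "\<lambda>x. frechet_derivative g (at x)"
  have D: "(g has_derivative ?D x) (at x)" if "x \<in> W" for x
    using g that times_cont_diff_on_derivative[of 0] by simp
  have cont: "continuous_on W (\<lambda>x. ?D x v)" for v
    using g by simp
  have "continuous_on W (\<lambda>x. ?D x v $ i)" for v i
    by (intro continuous_intros cont)
  then have "continuous_on W (\<lambda>x. det (matrix (?D x)))"
    using times_cont_diff_on_det[of W 0 "\<lambda>x. matrix (?D x)"] W by (simp add: matrix_def)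
  then have "open (W \<inter> (\<lambda>x. det (matrix (?D x))) -` (- {0}))"
    using W by (intro continuous_open_preimage) auto
  moreover obtain e where e: "e > 0" "ball p e \<subseteq> W" "inj_on g (ball p e)"
  proof -
    have lin: "linear (?D p)" using D[OF p] has_derivative_linear by blast
    then have "inj (?D p)" using nz det_nz_iff_inj by blast
    then obtain G where G: "linear G" "G \<circ> ?D p = id"
      using linear_injective_left_inverse[OF lin] by blast
    have "\<exists>d>0. \<forall>x. dist p x < d \<longrightarrow> onorm (\<lambda>v. frechet_derivative g (at (x)) v - ?D p v) < e"
      if "e > 0" for e
    proof -
      have "continuous_on W (\<lambda>x. \<Sum>b\<in>Basis. norm (?D x b - ?D p b))"
        by (intro continuous_intros cont)
      then have "open (W \<inter> (\<lambda>x. \<Sum>b\<in>Basis. norm (?D x b - ?D p b)) -` {..<e})"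
        using W by (intro continuous_open_preimage) auto
      moreover have "p \<in> W \<inter> (\<lambda>x. \<Sum>b\<in>Basis. norm (?D x b - ?D p b)) -` {..<e}"
        using p that by simp
      ultimately obtain d where d: "d > 0"
          "ball p d \<subseteq> W \<inter> (\<lambda>x. \<Sum>b\<in>Basis. norm (?D x b - ?D p b)) -` {..<e}"
        by (meson open_contains_ball)
      have "onorm (\<lambda>v. ?D x v - ?D p v) < e" if "dist p x < d" for x
      proof -
        have x: "x \<in> W" "(\<Sum>b\<in>Basis. norm (?D x b - ?D p b)) < e" using d(2) that by auto
        have "bounded_linear (\<lambda>v. ?D x v - ?D p v)"
          using D[OF x(1)] D[OF p] by (intro bounded_linear_sub has_derivative_bounded_linear)
        then show ?thesis
          using onorm_componentwise x(2) by fastforce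
      qed
      then show ?thesis using d(1) by blast
    qed
    note small = this
    have "bounded_linear G" using G(1) linear_conv_bounded_linear by blast
    then show ?thesis
      by (rule has_derivative_locally_injective[OF p W _ G(2) D small]) (assumption | rule that)+
  qed
  ultimately show ?thesis
    using p nz
    by (intro that[of "(W \<inter> (\<lambda>x. det (matrix (?D x))) -` (- {0})) \<inter> ball p e"])
      (auto intro: inj_on_subset)
qed

text \<open>At a boundary point the coordinate representation of \<open>f\<close> is defined only on a piece of a
  half-space, but by definition of smoothness it extends to an open set. The derivative within the
  half-space is unique, so it is the derivative of the extension, which is therefore regular at the
  point. This lemma carries all information about \<open>f\<close> used in the three results that follow it.\<close>

lemma regular_local_extension:
  fixes A :: "('a::topological_space, 'n::{finite,linorder}) chart set"
    and B :: "('b::topological_space, 'n) chart set"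
  assumes r: "1 \<le> r" and A: "Cr_structure r X A" and B: "Cr_structure r Y B"
    and f: "Cr_mapping r X A Y B f" and nd: "nondegenerate_differential X A B f"
    and c: "(U, \<phi>) \<in> A" and d: "(V, \<psi>) \<in> B" and x: "x \<in> U" "f x \<in> V"
  obtains W g where "open W" "\<phi> x \<in> W" "inj_on g W"
    "\<And>k. enat k \<le> r \<Longrightarrow> times_cont_diff_on k g W"
    "\<And>z. z \<in> W \<Longrightarrow> det (matrix (frechet_derivative g (at z))) \<noteq> 0"
    "\<And>u. u \<in> U \<Longrightarrow> \<phi> u \<in> W \<Longrightarrow> f u \<in> V \<and> g (\<phi> u) = \<psi> (f u)"
proof -
  have cc: "is_chart X (U, \<phi>)" and dc: "is_chart Y (V, \<psi>)"
    using A B c d by (auto simp: Cr_structure_def)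
  note U = chart_openin[OF cc] and hom = chart_homeomorphism[OF cc]
  have inj: "inj_on \<phi> U"
    using hom by (metis homeomorphism_def inj_on_inverseI)
  let ?S = "coord_domain f (U, \<phi>) (V, \<psi>)" and ?h = "coord_rep f (U, \<phi>) (V, \<psi>)" and ?p = "\<phi> x"
  have S: "?S = \<phi> ` (U \<inter> f -` V)" by (simp add: coord_domain_def)
  have pS: "?p \<in> ?S" using x by (auto simp: S)
  have rep: "?h (\<phi> u) = \<psi> (f u)" if "u \<in> U" for u
    using inj that by (simp add: coord_rep_def)
  have UX: "U \<subseteq> X" using U by (rule openin_imp_subset)
  have "openin (top_of_set U) (U \<inter> f -` V)"
    using f chart_openin[OF dc] UX unfolding Cr_mapping_def
    by (intro continuous_openin_preimage[of _ _ Y]) (auto intro: continuous_on_subset)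
  then have "openin (top_of_set (\<phi> ` U)) ?S"
    unfolding S by (rule homeomorphism_imp_open_map[OF hom])
  then obtain Q where Q: "open Q" "?S = \<phi> ` U \<inter> Q"
    by (auto simp: openin_open)
  have "Cr_on r ?h ?S"
    using f c d by (auto simp: Cr_mapping_def)
  then obtain W0 g where W0: "open W0" "?p \<in> W0" and gh: "\<forall>z\<in>?S \<inter> W0. g z = ?h z"
    and gk: "\<forall>k. enat k \<le> r \<longrightarrow> times_cont_diff_on k g W0"
    using pS by (auto simp: Cr_on_def)
  have g1: "times_cont_diff_on 1 g W0"
    using gk r by (metis one_enat_def)
  let ?g' = "frechet_derivative g (at ?p)"
  have g': "(g has_derivative ?g') (at ?p)"
    using g1 W0(2) times_cont_diff_on_derivative[of 0] by simp
  have hS: "(?h has_derivative ?g') (at ?p within ?S)"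
  proof -
    obtain e where "e > 0" "ball ?p e \<subseteq> W0"
      using W0 by (meson open_contains_ball)
    then show ?thesis
      using gh by (intro has_derivative_transform_within[OF has_derivative_at_withinI[OF g'] _ pS, of e])
        (auto simp: dist_commute subset_iff)
  qed
  have "frechet_derivative ?h (at ?p within ?S) = ?g'"
  (* Small positive multiples of every basis vector stay inside the coordinate domain. *)
  proof (rule frechet_derivative_unique_within)
    show "(?h has_derivative frechet_derivative ?h (at ?p within ?S)) (at ?p within ?S)"
      using differentiableI[OF hS] by (simp only: frechet_derivative_works)
    show "(?h has_derivative ?g') (at ?p within ?S)" by (rule hS)
    fix b :: "real ^ 'n::{finite,linorder}" and e :: real assume b: "b \<in> Basis" and "e > 0"
    have "?p \<in> Q" using Q(2) pS by blast
    then obtain \<delta> where \<delta>: "\<delta> > 0" "ball ?p \<delta> \<subseteq> Q"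
      using Q(1) by (meson open_contains_ball)
    define t where "t = min (e/2) (\<delta>/2)"
    have t: "0 < t" "t < e" "t < \<delta>" using \<open>e > 0\<close> \<delta>(1) by (auto simp: t_def)
    have "?p + t *\<^sub>R b \<in> ball ?p \<delta>"
      using t b by (simp add: dist_norm)
    moreover have "?p + t *\<^sub>R b \<in> \<phi> ` U"
      using chart_image_translate[OF cc _ b, of ?p t] x(1) t by auto
    ultimately have "?p + t *\<^sub>R b \<in> ?S" using Q(2) \<delta>(2) by blast
    then show "\<exists>t. 0 < \<bar>t\<bar> \<and> \<bar>t\<bar> < e \<and> ?p + t *\<^sub>R b \<in> ?S"
      using t by (intro exI[of _ t]) auto
  qed
  moreover have "coord_rank f (U, \<phi>) (V, \<psi>) x = CARD('n)"
    using nd c d x UX unfolding nondegenerate_differential_def by fastforce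
  ultimately have "rank (matrix ?g') = CARD('n)"
    by (simp add: coord_rank_def)
  then have "inj ((*v) (matrix ?g'))"
    by (simp add: full_rank_injective)
  then have "det (matrix ?g') \<noteq> 0"
    using det_nz_iff_inj[of "(*v) (matrix ?g')"] by simp
  then obtain W where W: "open W" "?p \<in> W" "W \<subseteq> W0" "inj_on g W"
    "\<And>z. z \<in> W \<Longrightarrow> det (matrix (frechet_derivative g (at z))) \<noteq> 0"
    using regular_point_neighbourhood[OF W0(1) g1 W0(2)] by metis
  show ?thesis
  proof (rule that[of "W \<inter> Q" g])
    show "open (W \<inter> Q)" "?p \<in> W \<inter> Q" "inj_on g (W \<inter> Q)"
      using W Q pS by (auto intro: inj_on_subset)
    show "times_cont_diff_on k g (W \<inter> Q)" if "enat k \<le> r" for k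
      using gk that W(3) times_cont_diff_on_subset by blast
    show "det (matrix (frechet_derivative g (at z))) \<noteq> 0" if "z \<in> W \<inter> Q" for z
      using W(5) that by blast
    show "f u \<in> V \<and> g (\<phi> u) = \<psi> (f u)" if u: "u \<in> U" "\<phi> u \<in> W \<inter> Q" for u
    proof -
      have uS: "\<phi> u \<in> ?S" using u Q(2) by blast
      then obtain u' where "u' \<in> U" "f u' \<in> V" "\<phi> u' = \<phi> u" by (auto simp: S)
      then have "f u \<in> V" using inj u by (metis inj_onD)
      moreover have "g (\<phi> u) = ?h (\<phi> u)" using gh uS u W(3) by blast
      ultimately show ?thesis using rep[OF u(1)] by simp
    qed
  qed
qed

lemma nondegenerate_locally_injective:
  fixes A :: "('a::topological_space, 'n::{finite,linorder}) chart set"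
    and B :: "('b::topological_space, 'n) chart set"
  assumes r: "1 \<le> r" and A: "Cr_structure r X A" and B: "Cr_structure r Y B"
    and f: "Cr_mapping r X A Y B f" and nd: "nondegenerate_differential X A B f"
    and x: "x \<in> X"
  obtains T where "openin (top_of_set X) T" "x \<in> T" "inj_on f T"
proof -
  obtain U \<phi> where c: "(U, \<phi>) \<in> A" "x \<in> U"
    using A x by (force simp: Cr_structure_def)
  have "f x \<in> Y" using f x by (auto simp: Cr_mapping_def)
  then obtain V \<psi> where d: "(V, \<psi>) \<in> B" "f x \<in> V"
    using B by (force simp: Cr_structure_def)
  obtain W g where W: "open W" "\<phi> x \<in> W" "inj_on g W"
    and gf: "\<And>u. u \<in> U \<Longrightarrow> \<phi> u \<in> W \<Longrightarrow> f u \<in> V \<and> g (\<phi> u) = \<psi> (f u)"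
    using regular_local_extension[OF r A B f nd c(1) d(1) c(2) d(2)] by metis
  have cc: "is_chart X (U, \<phi>)" using A c by (auto simp: Cr_structure_def)
  note hom = chart_homeomorphism[OF cc]
  show ?thesis
  proof
    have "openin (top_of_set U) (U \<inter> \<phi> -` W)"
      using hom W(1) by (intro continuous_openin_preimage_gen) (auto simp: homeomorphism_def)
    then show "openin (top_of_set X) (U \<inter> \<phi> -` W)"
      using chart_openin[OF cc] openin_trans by blast
    show "x \<in> U \<inter> \<phi> -` W" using c W by simp
    have "inj_on \<phi> U" using hom by (metis homeomorphism_def inj_on_inverseI)
    show "inj_on f (U \<inter> \<phi> -` W)"
    proof (rule inj_onI)
      fix u v assume uv: "u \<in> U \<inter> \<phi> -` W" "v \<in> U \<inter> \<phi> -` W" "f u = f v"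
      then have "g (\<phi> u) = g (\<phi> v)" using gf by auto
      then have "\<phi> u = \<phi> v" using W(3) uv by (auto dest: inj_onD)
      then show "u = v" using \<open>inj_on \<phi> U\<close> uv by (auto dest: inj_onD)
    qed
  qed
qed

text \<open>Read in charts, \<open>f\<close> is the restriction of an injective map \<open>g\<close> to the model domain. The hypothesis
  on boundaries says that \<open>g\<close> maps the frontier of one model domain into the frontier of the other,
  which is what prevents \<open>f\<close> from folding a boundary point of \<open>X\<close> into the interior of \<open>Y\<close>.\<close>

lemma nondegenerate_open_map:
  fixes A :: "('a::topological_space, 'n::{finite,linorder}) chart set"
    and B :: "('b::topological_space, 'n) chart set"
  assumes r: "1 \<le> r" and A: "Cr_structure r X A" and B: "Cr_structure r Y B"
    and f: "Cr_mapping r X A Y B f" and nd: "nondegenerate_differential X A B f"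
    and bd: "f ` manifold_boundary TYPE('n) X \<subseteq> manifold_boundary TYPE('n) Y"
    and T: "openin (top_of_set X) T"
  shows "openin (top_of_set Y) (f ` T)"
proof (subst openin_subopen, intro ballI)
  fix y assume "y \<in> f ` T"
  then obtain x where xT: "x \<in> T" and y: "y = f x" by blast
  then have xX: "x \<in> X" using T openin_imp_subset by blast
  obtain U \<phi> where c: "(U, \<phi>) \<in> A" "x \<in> U"
    using A xX by (force simp: Cr_structure_def)
  have "f x \<in> Y" using f xX by (auto simp: Cr_mapping_def)
  then obtain V \<psi> where d: "(V, \<psi>) \<in> B" "f x \<in> V"
    using B by (force simp: Cr_structure_def)
  obtain W g where W: "open W" "\<phi> x \<in> W" "inj_on g W"
    and gk: "\<And>k. enat k \<le> r \<Longrightarrow> times_cont_diff_on k g W"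
    and gf: "\<And>u. u \<in> U \<Longrightarrow> \<phi> u \<in> W \<Longrightarrow> f u \<in> V \<and> g (\<phi> u) = \<psi> (f u)"
    using regular_local_extension[OF r A B f nd c(1) d(1) c(2) d(2)] by metis
  have cc: "is_chart X (U, \<phi>)" and dc: "is_chart Y (V, \<psi>)"
    using A B c d by (auto simp: Cr_structure_def)
  note hom = chart_homeomorphism[OF cc] and homd = chart_homeomorphism[OF dc]
  have inj: "inj_on \<phi> U" "inj_on \<psi> V"
    using hom homd by (metis homeomorphism_def inj_on_inverseI)+
  have "openin (top_of_set U) (U \<inter> T)"
    using T chart_openin[OF cc] by (meson openin_Int openin_imp_subset openin_subset_trans inf_le1)
  then have "openin (top_of_set (\<phi> ` U)) (\<phi> ` (U \<inter> T))"
    by (rule homeomorphism_imp_open_map[OF hom])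
  then obtain Q where Q: "open Q" "\<phi> ` (U \<inter> T) = \<phi> ` U \<inter> Q"
    by (auto simp: openin_open)
  have QT: "u \<in> T" if "u \<in> U" "\<phi> u \<in> Q" for u
  proof -
    have "\<phi> u \<in> \<phi> ` (U \<inter> T)" using that Q(2) by blast
    then show ?thesis using inj(1) that by (metis IntE imageE inj_onD)
  qed
  have xQ: "\<phi> x \<in> Q" using Q(2) c xT by blast
  let ?W = "W \<inter> Q"
  obtain N where N: "open N" "g (\<phi> x) \<in> N" "N \<inter> \<psi> ` V \<subseteq> g ` (?W \<inter> \<phi> ` U)"
  proof (rule neighbourhood_in_convex_image[of ?W g "\<phi> ` U" "\<psi> ` V" "\<phi> x"])
    show "continuous_on ?W g"
      using gk[of 0] by (auto simp: zero_enat_def[symmetric] intro: continuous_on_subset)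
    show "g ` (?W \<inter> \<phi> ` U) \<subseteq> \<psi> ` V"
      using gf by auto
    show "g ` (?W \<inter> frontier (\<phi> ` U)) \<subseteq> frontier (\<psi> ` V)"
    proof clarify
      fix z assume z: "z \<in> W" "z \<in> Q" "z \<in> frontier (\<phi> ` U)"
      then have "z \<in> \<phi> ` U"
        using chart_image_closed[OF cc] by (auto simp: frontier_def)
      then obtain u where u: "u \<in> U" "z = \<phi> u" by blast
      then have "u \<in> manifold_boundary TYPE('n) X"
        using z(3) manifold_boundary_chart[OF cc u(1)] by simp
      then have "f u \<in> manifold_boundary TYPE('n) Y" using bd by blast
      then show "g z \<in> frontier (\<psi> ` V)"
        using manifold_boundary_chart[OF dc, of "f u"] gf[OF u(1)] z(1) u(2) by auto
    qed
  qed (use W Q xQ c(2) chart_image_closed[OF cc] chart_image_convex[OF cc] chart_image_interior[OF cc]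
      chart_image_convex[OF dc] chart_image_interior[OF dc] in \<open>auto intro: inj_on_subset\<close>)
  have "openin (top_of_set V) (V \<inter> \<psi> -` N)"
    using homd N(1) by (intro continuous_openin_preimage_gen) (auto simp: homeomorphism_def)
  then have "openin (top_of_set Y) (V \<inter> \<psi> -` N)"
    using chart_openin[OF dc] openin_trans by blast
  moreover have "y \<in> V \<inter> \<psi> -` N"
    using y d(2) N(2) gf[OF c(2) W(2)] by simp
  moreover have "V \<inter> \<psi> -` N \<subseteq> f ` T"
  proof
    fix v assume v: "v \<in> V \<inter> \<psi> -` N"
    then have "\<psi> v \<in> g ` (?W \<inter> \<phi> ` U)" using N(3) by blast
    then obtain u where u: "u \<in> U" "\<phi> u \<in> W" "\<phi> u \<in> Q" "\<psi> v = g (\<phi> u)" by blast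
    then have "\<psi> v = \<psi> (f u)" "f u \<in> V" using gf by auto
    then have "v = f u" using inj(2) v by (auto dest: inj_onD)
    then show "v \<in> f ` T" using QT u by blast
  qed
  ultimately show "\<exists>N. openin (top_of_set Y) N \<and> y \<in> N \<and> N \<subseteq> f ` T" by blast
qed

text \<open>Near a point, the inverse of \<open>f\<close> in charts is the restriction of the inverse of the regular
  extension \<open>g\<close>. For this the neighbourhood of \<open>q\<close> is shrunk, by continuity of the inverse of \<open>f\<close>,
  until that inverse takes values in the domain where \<open>g\<close> is injective.\<close>

lemma inverse_Cr_mapping:
  fixes A :: "('a::topological_space, 'n::{finite,linorder}) chart set"
    and B :: "('b::topological_space, 'n) chart set"
  assumes r: "1 \<le> r" and A: "Cr_structure r X A" and B: "Cr_structure r Y B"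
    and f: "Cr_mapping r X A Y B f" and nd: "nondegenerate_differential X A B f"
    and bij: "bij_betw f X Y"
    and op: "\<And>T. openin (top_of_set X) T \<Longrightarrow> openin (top_of_set Y) (f ` T)"
  shows "Cr_mapping r Y B X A (inv_into X f)"
proof -
  let ?e = "inv_into X f"
  have inj: "inj_on f X" and im: "f ` X = Y" using bij by (auto simp: bij_betw_def)
  have eX: "?e y \<in> X" and fe: "f (?e y) = y" if "y \<in> Y" for y
    using that im by (auto simp: inv_into_into f_inv_into_f)
  have cont: "continuous_on Y ?e"
    by (rule continuous_on_inverse_open_map[OF _ im]) (use f inj op in \<open>auto simp: Cr_mapping_def\<close>)
  have "Cr_on r (coord_rep ?e d c) (coord_domain ?e d c)" if d: "d \<in> B" and c: "c \<in> A" for d c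
    unfolding Cr_on_def
  proof
    obtain V \<psi> where dV: "d = (V, \<psi>)" by (cases d)
    obtain U \<phi> where cU: "c = (U, \<phi>)" by (cases c)
    fix q assume "q \<in> coord_domain ?e d c"
    then obtain v where v: "v \<in> V" "?e v \<in> U" "q = \<psi> v"
      by (auto simp: coord_domain_def dV cU)
    have cc: "is_chart X (U, \<phi>)" and dc: "is_chart Y (V, \<psi>)"
      using A B c d by (auto simp: Cr_structure_def cU dV)
    note hom = chart_homeomorphism[OF cc] and homd = chart_homeomorphism[OF dc]
    have injd: "inj_on \<psi> V" using homd by (metis homeomorphism_def inj_on_inverseI)
    have VY: "V \<subseteq> Y" using chart_openin[OF dc] by (rule openin_imp_subset)
    let ?x = "?e v"
    have fx: "f ?x = v" using fe v(1) VY by blast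
    then have fxV: "f ?x \<in> V" using v(1) by simp
    obtain W g where W: "open W" "\<phi> ?x \<in> W" "inj_on g W"
      and gk: "\<And>k. enat k \<le> r \<Longrightarrow> times_cont_diff_on k g W"
      and nz: "\<And>z. z \<in> W \<Longrightarrow> det (matrix (frechet_derivative g (at z))) \<noteq> 0"
      and gf: "\<And>u. u \<in> U \<Longrightarrow> \<phi> u \<in> W \<Longrightarrow> f u \<in> V \<and> g (\<phi> u) = \<psi> (f u)"
      using regular_local_extension[OF r A B f nd c[unfolded cU] d[unfolded dV] v(2) fxV] by metis
    have g0: "continuous_on W g"
      using gk[of 0] by (simp add: zero_enat_def[symmetric])
    obtain h where h: "homeomorphism W (g ` W) g h"
      using invariance_of_domain_homeomorphism[OF W(1) g0 _ W(3)] by auto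
    have G: "open (g ` W)" using invariance_of_domain[OF g0 W(1,3)] .
    let ?T = "U \<inter> \<phi> -` W"
    have "openin (top_of_set U) ?T"
      using hom W(1) by (intro continuous_openin_preimage_gen) (auto simp: homeomorphism_def)
    then have T: "openin (top_of_set X) ?T"
      using chart_openin[OF cc] openin_trans by blast
    have "openin (top_of_set V) (V \<inter> ?e -` ?T)"
      by (rule continuous_openin_preimage[OF continuous_on_subset[OF cont VY] _ T]) (use eX VY in auto)
    then have "openin (top_of_set (\<psi> ` V)) (\<psi> ` (V \<inter> ?e -` ?T))"
      by (rule homeomorphism_imp_open_map[OF homd])
    then obtain N where N: "open N" "\<psi> ` (V \<inter> ?e -` ?T) = \<psi> ` V \<inter> N"
      by (auto simp: openin_open)
    have "q \<in> N" using N(2) v W(2) by blast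
    moreover have "q \<in> g ` W" using gf[OF v(2) W(2)] W(2) v(3) fx by (metis imageI)
    moreover have "h z = coord_rep ?e d c z" if z: "z \<in> coord_domain ?e d c" "z \<in> N" for z
    proof -
      obtain w where w: "w \<in> V" "z = \<psi> w" using z(1) by (auto simp: coord_domain_def dV cU)
      then have "z \<in> \<psi> ` (V \<inter> ?e -` ?T)" using N(2) z(2) by blast
      then have eT: "?e w \<in> U" "\<phi> (?e w) \<in> W"
        using w injd by (auto dest: inj_onD)
      have "g (\<phi> (?e w)) = z"
        using gf[OF eT] fe[of w] w VY by auto
      then have "h z = \<phi> (?e w)"
        using homeomorphism_apply1[OF h eT(2)] by simp
      then show ?thesis
        using injd w by (simp add: coord_rep_def dV cU)
    qed
    moreover have "times_cont_diff_on k h (N \<inter> g ` W)" if "enat k \<le> r" for k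
      by (rule times_cont_diff_on_subset[OF
            times_cont_diff_on_inverse_function[OF W(1) G h gk[OF that] nz]]) auto
    ultimately show "\<exists>W h. open W \<and> q \<in> W \<and> (\<forall>z\<in>coord_domain ?e d c \<inter> W. h z = coord_rep ?e d c z) \<and>
        (\<forall>k. enat k \<le> r \<longrightarrow> times_cont_diff_on k h W)"
      using N(1) G by (intro exI[of _ "N \<inter> g ` W"] exI[of _ h]) auto
  qed
  then show ?thesis
    using cont eX unfolding Cr_mapping_def by blast
qed

section \<open>One-sheeted coverings of manifolds\<close>

text \<open>Chart domains are images of convex sets, so path components are open.\<close>

lemma connected_manifold_path_connected:
  fixes A :: "('a::topological_space, 'n::{finite,linorder}) chart set"
  assumes A: "Cr_structure r X A" and X: "connected X"
  shows "path_connected X"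
proof -
  have nbhd: "\<exists>U. openin (top_of_set X) U \<and> a \<in> U \<and> (\<forall>x\<in>U. path_component X a x)" if a: "a \<in> X" for a
  proof -
    obtain U \<phi> where c: "(U, \<phi>) \<in> A" "a \<in> U"
      using A a by (force simp: Cr_structure_def)
    have cc: "is_chart X (U, \<phi>)" using A c by (auto simp: Cr_structure_def)
    note U = chart_openin[OF cc] and hom = chart_homeomorphism[OF cc]
    have "path_connected (inv_into U \<phi> ` \<phi> ` U)"
      using path_connected_continuous_image[OF homeomorphism_cont2[OF hom]]
        convex_imp_path_connected[OF chart_image_convex[OF cc]] .
    then have "path_connected U"
      using homeomorphism_image2[OF hom] by simp
    then have "path_component X a x" if "x \<in> U" for x
      using that c(2) openin_imp_subset[OF U] path_component_of_subset
      unfolding path_connected_component by metis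
    then show ?thesis using U c(2) by blast
  qed
  have "path_component X a b" if "a \<in> X" "b \<in> X" for a b
    by (rule connected_equivalence_relation[OF X that, where R = "path_component X"])
      (use nbhd in \<open>auto intro: path_component_sym path_component_trans\<close>)
  then show ?thesis
    unfolding path_connected_component by blast
qed

theorem theorem2p4:
  fixes r :: enat
    and X :: "'a::topological_space set"
    and Y :: "'b::topological_space set"
    and A :: "('a, 'n::{finite,linorder}) chart set"
    and B :: "('b, 'n) chart set"
    and f :: "'a \<Rightarrow> 'b"
    and x0 :: 'a and y0 :: 'b
  assumes "1 \<le> r"
    and "Cr_manifold r X A" and "connected X" and "compact X"
    and "Cr_manifold r Y B" and "connected Y"
    and "Cr_mapping r X A Y B f"
    and "nondegenerate_differential X A B f"
    and "f ` manifold_boundary TYPE('n) X \<subseteq> manifold_boundary TYPE('n) Y"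
    and "x0 \<in> X" and "y0 \<in> Y"
    and "\<not> (\<exists>H. subgroup H (fundamental_group Y y0) \<and>
               H \<noteq> carrier (fundamental_group Y y0) \<and>
               finite (rcosets\<^bsub>fundamental_group Y y0\<^esub> H) \<and>
               (fundamental_group Y y0)\<lparr>carrier := H\<rparr> \<cong> fundamental_group X x0)"
  shows "Cr_diffeomorphism r X A Y B f"
proof -
  have A: "Cr_structure r X A" and B: "Cr_structure r Y B"
    and hX: "Hausdorff_space (top_of_set X)" and hY: "Hausdorff_space (top_of_set Y)"
    using assms(2,5) by (auto simp: Cr_manifold_def topological_manifold_def)
  have cont: "continuous_on X f" and into: "f ` X \<subseteq> Y"
    using assms(7) by (auto simp: Cr_mapping_def)
  have op: "openin (top_of_set Y) (f ` T)" if "openin (top_of_set X) T" for T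
    by (rule nondegenerate_open_map[OF assms(1) A B assms(7,8,9) that])
  have inj: "\<exists>T. openin (top_of_set X) T \<and> x \<in> T \<and> inj_on f T" if "x \<in> X" for x
    using nondegenerate_locally_injective[OF assms(1) A B assms(7,8) that] by metis
  note covering = compact_local_homeomorphism_covering[OF hX hY assms(4) cont into inj op]
  interpret covering_projection X Y f by (rule covering(1))
  have "compactin (top_of_set Y) (f ` X)"
    using compact_continuous_image[OF cont assms(4)] into by (simp add: compactin_subtopology)
  then have "closedin (top_of_set Y) (f ` X)"
    by (rule compactin_imp_closedin[OF hY])
  moreover have "openin (top_of_set Y) (f ` X)"
    using op[of X] by simp
  ultimately have surj: "f ` X = Y"
    using assms(6,10) unfolding connected_clopen by blast
  have "inj_on f X"
    using assms(10,11,12) surj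
    by (intro injective_if_no_subgroup[OF connected_manifold_path_connected[OF A assms(3)] _ assms(10)
          covering(2)]) auto
  then have bij: "bij_betw f X Y"
    using surj by (simp add: bij_betw_def)
  show ?thesis
    unfolding Cr_diffeomorphism_def
    using bij assms(7) inverse_Cr_mapping[OF assms(1) A B assms(7,8) bij op] by blast
qed

end
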